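(* If $\mathcal X$ is a Hilbert space, then $$\mathcal B_1[\mathcal X]=\mathcal B_N[\mathcal X]\quad\text{and}\quad\|\cdot\|_1=\|\cdot\|_N .$$ That is, an operator on $\mathcal X$ is trace-class if and only if it is nuclear, and its trace norm coincides with its nuclear norm.
   Context: Hilbert spaces are over $\mathbb F=\mathbb R$ or $\mathbb C$ and not necessarily separable. $\mathcal B[\mathcal X]$ is the algebra of all bounded linear operators on $\mathcal X$, and $\mathcal X^*$ is the dual of $\mathcal X$. The inner product $\langle\cdot\,;\cdot\rangle$ is linear in the first argument. Trace-class: for $T\in\mathcal B[\mathcal X]$ set $|T|=(T^*T)^{1/2}$. $T$ is trace-class if $\sum_\gamma\langle|T|e_\gamma;e_\gamma\rangle<\infty$ for an arbitrary orthonormal basis $\{e_\gamma\}$ of $\mathcal X$ (the value of the sum does not depend on the basis). $\mathcal B_1[\mathcal X]$ is the set of all trace-class operators, and $\|T\|_1=\sum_\gamma\langle|T|e_\gamma;e_\gamma\rangle$ is the trace norm. Nuclear: $T\in\mathcal B[\mathcal X]$ is nuclear if there are an $\mathcal X^*$-valued sequence $\{f_k\}$ and an $\mathcal X$-valued sequence $\{y_k\}$ such that $\sum_k\|f_k\|\,\|y_k\|<\infty$ and $Tx=\sum_k f_k(x)\,y_k$ for every $x\in\mathcal X$ (a nuclear representation of $T$). Equivalently, by Riesz representation, there are $\mathcal X$-valued sequences $\{z_k\},\{y_k\}$ with $\sum_k\|z_k\|\,\|y_k\|<\infty$ and $Tx=\sum_k\langle x;z_k\rangle y_k$ for every $x\in\mathcal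 X$. $\mathcal B_N[\mathcal X]$ is the set of all nuclear operators on $\mathcal X$, and the nuclear norm is $\|T\|_N=\inf\sum_k\|f_k\|\,\|y_k\|$, the infimum over all nuclear representations of $T$. *)

theory Defs
  imports "HOL-Analysis.Analysis"
begin

text \<open>
  The scalar fields \<open>\<real>\<close> and \<open>\<complex>\<close> are treated uniformly by a type class that has exactly these two
  members up to isometric isomorphism: see the two instances and the lemma \<open>rc_scalar_cases\<close> below
  (the norm is determined by \<open>mult_rcnj\<close>). The scaled unit stands for \<open>of_real\<close>, which is not
  available in the class context.
\<close>

class rc_scalar = real_normed_field +
  fixes rcnj :: "'a \<Rightarrow> 'a"
  assumes rcnj_add: "rcnj (x + y) = rcnj x + rcnj y"
    and rcnj_mult: "rcnj (x * y) = rcnj x * rcnj y"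
    and rcnj_rcnj: "rcnj (rcnj x) = x"
    and mult_rcnj_scaleR: "x * rcnj x = (norm x)\<^sup>2 *\<^sub>R 1"
    and add_rcnj_scaleR: "\<exists>r. x + rcnj x = r *\<^sub>R 1"

instantiation real :: rc_scalar
begin
definition rcnj_real :: "real \<Rightarrow> real" where "rcnj_real x = x"
instance by standard (auto simp: rcnj_real_def power2_eq_square)
end

instantiation complex :: rc_scalar
begin
definition rcnj_complex :: "complex \<Rightarrow> complex" where "rcnj_complex x = cnj x"
instance
proof
  fix x y :: complex
  show "x * rcnj x = (norm x)\<^sup>2 *\<^sub>R 1"
    unfolding rcnj_complex_def scaleR_conv_of_real mult_1_right by (rule complex_norm_square[symmetric])
  have "x + rcnj x = (2 * Re x) *\<^sub>R 1"
    unfolding rcnj_complex_def scaleR_conv_of_real mult_1_right by (rule complex_add_cnj)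
  then show "\<exists>r. x + rcnj x = r *\<^sub>R 1" ..
qed (simp_all add: rcnj_complex_def)
end

lemma mult_rcnj: "(x::'f::rc_scalar) * rcnj x = of_real ((norm x)\<^sup>2)"
  unfolding of_real_def by (rule mult_rcnj_scaleR)

lemma add_rcnj: "(x::'f::rc_scalar) + rcnj x \<in> \<real>"
  using add_rcnj_scaleR[of x] by (auto simp: Reals_def of_real_def)

lemma rcnj_of_real: "rcnj (of_real r :: 'f::rc_scalar) = of_real r"
proof (cases "r = 0")
  case True
  have "rcnj (0::'f) + rcnj 0 = rcnj 0" using rcnj_add[of "0::'f" 0] by simp
  then show ?thesis using True by simp
next
  case False
  have "(of_real r :: 'f) * rcnj (of_real r) = of_real r * of_real r"
    unfolding mult_rcnj of_real_mult[symmetric] by (simp add: power2_eq_square)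
  then show ?thesis using False by (metis mult_left_cancel of_real_eq_0_iff)
qed

lemma rcnj_fixed: "rcnj (x::'f::rc_scalar) = x \<Longrightarrow> x \<in> \<real>"
proof -
  assume "rcnj x = x"
  then have "2 * x \<in> \<real>" using add_rcnj[of x] by (metis mult_2)
  then have "(2 * x) / 2 \<in> \<real>" by (intro Reals_divide) auto
  then show "x \<in> \<real>" by simp
qed

lemma rcnj_minus: "rcnj (- x) = - rcnj (x::'f::rc_scalar)"
proof -
  have "rcnj (-1 * x) = - rcnj x"
    using rcnj_of_real[of "-1", where 'f='f] by (simp only: rcnj_mult) simp
  then show ?thesis by simp
qed

lemma rc_scalar_cases:
  "(\<forall>x::'f::rc_scalar. x \<in> \<real>) \<or>
   (\<exists>i::'f. i * i = - 1 \<and> rcnj i = - i \<and> (\<forall>x. \<exists>a b. x = of_real a + of_real b * i))"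
proof (cases "\<forall>x::'f. x \<in> \<real>")
  case False
  have split: "\<exists>a e. x = of_real a + e \<and> rcnj e = - e" for x :: 'f
  proof -
    obtain s where s: "x + rcnj x = of_real s" using add_rcnj[of x] by (auto elim: Reals_cases)
    have "x + rcnj x = of_real (s/2) + of_real (s/2)" unfolding s by (simp flip: of_real_add)
    then have "rcnj x = of_real (s/2) + of_real (s/2) - x" by (metis add_diff_cancel_left')
    then have "rcnj (x + of_real (- (s/2))) = - (x + of_real (- (s/2)))"
      unfolding rcnj_add rcnj_of_real by simp
    then show ?thesis
      by (intro exI[of _ "s/2"] exI[of _ "x + of_real (- (s/2))"]) simp
  qed
  from False obtain x :: 'f where x: "x \<notin> \<real>" by blast
  obtain a d where d: "x = of_real a + d" "rcnj d = - d" using split by blast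
  have d0: "d \<noteq> 0" using x d by auto
  define i where "i = d * of_real (1 / norm d)"
  have "- (d * d) = of_real ((norm d)\<^sup>2)" using mult_rcnj[of d] d(2) by simp
  then have dd: "d * d = - of_real ((norm d)\<^sup>2)" by (metis minus_minus)
  have "i * i = (d * d) * of_real (1 / (norm d)\<^sup>2)" by (simp add: i_def power2_eq_square)
  also have "\<dots> = - of_real ((norm d)\<^sup>2 * (1 / (norm d)\<^sup>2))" unfolding dd of_real_mult by simp
  also have "\<dots> = - 1" using d0 by simp
  finally have ii: "i * i = - 1" .
  have ci: "rcnj i = - i" unfolding i_def rcnj_mult rcnj_of_real d(2) by simp
  have "\<exists>a b. y = of_real a + of_real b * i" for y
  proof -
    obtain a e where e: "y = of_real a + e" "rcnj e = - e" using split by blast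
    have "e * i \<in> \<real>" by (rule rcnj_fixed) (simp add: rcnj_mult e ci)
    then obtain r where "e * i = of_real r" by (auto elim: Reals_cases)
    then have "e * (i * i) = of_real r * i" by (simp add: mult.assoc)
    then have "- e = of_real r * i" using ii by simp
    then have "e = of_real (- r) * i" by (metis minus_minus mult_minus_left of_real_minus)
    then show ?thesis using e by blast
  qed
  then show ?thesis using ii ci by blast
qed simp

text \<open>
  The norm and the completeness of the space come from the type class \<^class>\<open>banach\<close>; the locale adds
  the scalar multiplication over \<open>'f\<close>, extending the real one, and an inner product inducing the norm.
\<close>

locale hilbert_space = vector_space scale
  for scale :: "'f::rc_scalar \<Rightarrow> 'a::banach \<Rightarrow> 'a" +
  fixes ip :: "'a \<Rightarrow> 'a \<Rightarrow> 'f"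
  assumes scale_of_real: "scale (of_real r) x = r *\<^sub>R x"
    and ip_add_left: "ip (x + y) z = ip x z + ip y z"
    and ip_scale_left: "ip (scale c x) y = c * ip x y"
    and ip_commute: "ip y x = rcnj (ip x y)"
    and ip_self: "ip x x = of_real ((norm x)\<^sup>2)"
begin

definition bounded_op :: "('a \<Rightarrow> 'a) \<Rightarrow> bool" where
  "bounded_op T \<longleftrightarrow> bounded_linear T \<and> (\<forall>c x. T (scale c x) = scale c (T x))"

definition dual :: "('a \<Rightarrow> 'f) set" where
  "dual = {f. bounded_linear f \<and> (\<forall>c x. f (scale c x) = c * f x)}"

definition adj :: "('a \<Rightarrow> 'a) \<Rightarrow> ('a \<Rightarrow> 'a)" where
  "adj T = (THE S. \<forall>x y. ip (T x) y = ip x (S y))"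

text \<open>Self-adjointness is required explicitly, since over the reals it does not follow from the
  nonnegativity of the quadratic form.\<close>

definition nonneg_op :: "('a \<Rightarrow> 'a) \<Rightarrow> bool" where
  "nonneg_op T \<longleftrightarrow> bounded_op T \<and> adj T = T \<and> (\<forall>x. ip (T x) x \<in> \<real>\<^sub>\<ge>\<^sub>0)"

definition sqrt_op :: "('a \<Rightarrow> 'a) \<Rightarrow> ('a \<Rightarrow> 'a)" where
  "sqrt_op T = (THE R. nonneg_op R \<and> R \<circ> R = T)"

definition abs_op :: "('a \<Rightarrow> 'a) \<Rightarrow> ('a \<Rightarrow> 'a)" where
  "abs_op T = sqrt_op (adj T \<circ> T)"

definition orthonormal_basis :: "'a set \<Rightarrow> bool" where
  "orthonormal_basis E \<longleftrightarrow>
     (\<forall>e\<in>E. \<forall>e'\<in>E. ip e e' = (if e = e' then 1 else 0)) \<and> closure (span E) = UNIV"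

text \<open>The terms of the series are nonnegative, so that having a finite sum is the same as
  unconditional summability over the (possibly uncountable) basis.\<close>

definition trace_class :: "('a \<Rightarrow> 'a) set" where
  "trace_class =
     {T. bounded_op T \<and> (\<forall>E. orthonormal_basis E \<longrightarrow> (\<lambda>e. ip (abs_op T e) e) summable_on E)}"

definition trace_norm :: "('a \<Rightarrow> 'a) \<Rightarrow> real" where
  "trace_norm T =
     (THE s. \<forall>E. orthonormal_basis E \<longrightarrow> ((\<lambda>e. ip (abs_op T e) e) has_sum of_real s) E)"

definition nuclear_rep :: "('a \<Rightarrow> 'a) \<Rightarrow> (nat \<Rightarrow> 'a \<Rightarrow> 'f) \<Rightarrow> (nat \<Rightarrow> 'a) \<Rightarrow> bool" where
  "nuclear_rep T f y \<longleftrightarrow>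
     (\<forall>k. f k \<in> dual) \<and> summable (\<lambda>k. onorm (f k) * norm (y k)) \<and>
     (\<forall>x. (\<lambda>k. scale (f k x) (y k)) sums T x)"

definition nuclear :: "('a \<Rightarrow> 'a) set" where
  "nuclear = {T. bounded_op T \<and> (\<exists>f y. nuclear_rep T f y)}"

definition nuclear_norm :: "('a \<Rightarrow> 'a) \<Rightarrow> real" where
  "nuclear_norm T = Inf {\<Sum>k. onorm (f k) * norm (y k) | f y. nuclear_rep T f y}"

end

text \<open>Over the reals, the locale subsumes the library's complete real inner product spaces.\<close>

lemma hilbert_space_real:
  "hilbert_space scaleR (inner :: 'a::{real_inner,banach} \<Rightarrow> 'a \<Rightarrow> real)"
  by unfold_locales
    (auto simp: rcnj_real_def inner_commute inner_add_left power2_norm_eq_inner algebra_simps)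

lemma hilbert_space_complex: "hilbert_space (*) (\<lambda>x y :: complex. x * cnj y)"
  by unfold_locales
    (auto simp: rcnj_complex_def algebra_simps scaleR_conv_of_real
      complex_norm_square[unfolded of_real_power])

end

theory Submission
  imports Defs
begin

text \<open>
  Let \<open>P = |T|\<close>, and let \<open>V\<close>, \<open>W\<close> be contractions with \<open>V T = P\<close> and \<open>W P = T\<close>, as provided by the
  polar decomposition. Both halves of the theorem are read off by comparing, for one orthonormal
  basis \<open>E\<close> at a time, the sum of \<open>\<langle>P e; e\<rangle>\<close> over \<open>E\<close> with the sums
  \<open>\<Sum>\<^sub>k \<parallel>f\<^sub>k\<parallel> \<parallel>y\<^sub>k\<parallel>\<close> of nuclear representations.

  If \<open>T x = \<Sum>\<^sub>k f\<^sub>k(x) y\<^sub>k\<close>, then \<open>\<langle>P e; e\<rangle> = \<langle>V T e; e\<rangle> = \<Sum>\<^sub>k f\<^sub>k(e) \<langle>V y\<^sub>k; e\<rangle>\<close>. Summing over finitely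
  many \<open>e\<close>, the Cauchy-Schwarz inequality and Bessel's inequality for \<open>f\<^sub>k\<close> and for \<open>V y\<^sub>k\<close> bound the
  \<open>k\<close>-th contribution by \<open>\<parallel>f\<^sub>k\<parallel> \<parallel>y\<^sub>k\<parallel>\<close>. So the trace sum over any \<open>E\<close> is at most the sum of any nuclear
  representation (\<open>sum_abs_diag_le\<close>).

  Conversely, suppose that the trace sum over \<open>E\<close> is a finite number \<open>t\<close>, and let \<open>Q\<close> be the square
  root of \<open>P\<close>. Then \<open>T = W Q Q\<close>, and expanding \<open>Q x\<close> in the basis gives
  \<open>T x = \<Sum>\<^sub>e \<langle>x; Q e\<rangle> W Q e\<close>. The terms satisfy \<open>\<parallel>Q e\<parallel> \<parallel>W Q e\<parallel> \<le> \<parallel>Q e\<parallel>\<^sup>2 = \<langle>P e; e\<rangle>\<close>, so only countably many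
  of them are nonzero, and they form a nuclear representation with sum at most \<open>t\<close>
  (\<open>nuclear_rep_of_trace\<close>).

  Together, the trace sum over each basis is the least sum of a nuclear representation. This gives
  both equalities, and with them the independence of the trace sum from the basis.

  The Hilbert space theory behind this rests on two constructions. A minimisation argument
  (\<open>representation\<close>) yields at once the Riesz representation, orthogonal projections, adjoints and
  the polar decomposition. The power series of \<open>1 - sqrt(1 - z)\<close>, whose coefficients are
  nonnegative with sum at most one, yields square roots of positive operators.
\<close>

section \<open>Scalars\<close>

text \<open>
  The real part stands in for the scalar when inequalities are needed, since the field is not
  ordered. Being a bounded linear map to the reals, it also transports sums in the scalar field to
  real sums.
\<close>

definition re_part :: "'f::rc_scalar \<Rightarrow> real" where
  "re_part z = (SOME r. z + rcnj z = of_real (2 * r))"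

lemma add_rcnj_eq_re_part: "z + rcnj z = of_real (2 * re_part z)"
proof -
  obtain s where "z + rcnj z = of_real s" using add_rcnj[of z] by (auto elim: Reals_cases)
  then have "z + rcnj z = of_real (2 * (s / 2))" by simp
  then show ?thesis unfolding re_part_def by (rule someI)
qed

lemma re_part_eqI: "z + rcnj z = of_real (2 * r) \<Longrightarrow> re_part z = r"
  using add_rcnj_eq_re_part[of z] by (metis mult_left_cancel of_real_eq_iff zero_neq_numeral)

lemma re_part_add: "re_part (x + y) = re_part x + re_part y"
  using add_rcnj_eq_re_part[of x] add_rcnj_eq_re_part[of y]
  by (intro re_part_eqI) (simp add: rcnj_add algebra_simps)

lemma re_part_of_real_mult: "re_part (of_real r * z) = r * re_part z"
proof (rule re_part_eqI)
  have "of_real r * z + rcnj (of_real r * z) = of_real r * (z + rcnj z)"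
    by (simp add: rcnj_mult rcnj_of_real algebra_simps)
  then show "of_real r * z + rcnj (of_real r * z) = of_real (2 * (r * re_part z))"
    unfolding add_rcnj_eq_re_part by simp
qed

lemma re_part_of_real [simp]: "re_part (of_real r) = r"
  by (intro re_part_eqI) (simp add: rcnj_of_real)

lemma re_part_zero [simp]: "re_part 0 = 0"
  using re_part_of_real[of 0] by simp

lemma re_part_rcnj: "re_part (rcnj z) = re_part z"
  using add_rcnj_eq_re_part[of z] by (intro re_part_eqI) (simp add: rcnj_rcnj add.commute)

lemma re_part_minus: "re_part (- z) = - re_part z"
  using re_part_of_real_mult[of "-1" z] by simp

lemma re_part_diff: "re_part (x - y) = re_part x - re_part y"
  using re_part_add[of x "- y"] by (simp add: re_part_minus)

lemma rcnj_zero [simp]: "rcnj 0 = 0"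
  using rcnj_of_real[of 0] by simp

lemma norm_rcnj [simp]: "norm (rcnj z) = norm z"
proof (cases "z = 0")
  case False
  have "norm z * norm (rcnj z) = norm z * norm z"
    using arg_cong[OF mult_rcnj[of z], of norm] by (simp add: norm_mult power2_eq_square)
  then show ?thesis using False by simp
qed simp

lemma abs_re_part_le_norm: "\<bar>re_part z\<bar> \<le> norm z"
proof -
  have "2 * \<bar>re_part z\<bar> = norm (z + rcnj z)"
    unfolding add_rcnj_eq_re_part by (simp add: abs_mult del: of_real_mult)
  also have "\<dots> \<le> 2 * norm z" using norm_triangle_ineq[of z "rcnj z"] by simp
  finally show ?thesis by simp
qed

lemma bounded_linear_re_part: "bounded_linear re_part"
  by (intro bounded_linear_intro[where K = 1])
    (simp_all add: re_part_add scaleR_conv_of_real re_part_of_real_mult abs_re_part_le_norm)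

lemma of_real_re_part_if_fixed: "rcnj z = z \<Longrightarrow> of_real (re_part z) = z"
  by (metis Reals_cases rcnj_fixed re_part_of_real)

text \<open>
  Variational step: a quadratic polynomial in \<open>t\<close> that is minimal at \<open>t = 0\<close> has no linear term.
\<close>

lemma quadratic_nonneg_imp_zero:
  fixes a b :: real
  assumes "\<And>t. 0 \<le> t * a + t\<^sup>2 * b"
  shows "a = 0"
proof (rule ccontr)
  assume a: "a \<noteq> 0"
  define d where "d = \<bar>b\<bar> + 1"
  have d: "d > 0" "b < d" by (auto simp: d_def)
  \<comment> \<open>\<open>t\<close> is opposite in sign to \<open>a\<close> and so short that the linear term wins, as \<open>b < d\<close>\<close>
  have "0 \<le> (- a / d) * a + (- a / d)\<^sup>2 * b" by (rule assms)
  also have "\<dots> = (a\<^sup>2 / d) * (b / d - 1)" using d by (simp add: field_simps power2_eq_square)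
  also have "\<dots> < 0" using a d by (intro mult_pos_neg) auto
  finally show False by simp
qed

section \<open>The coefficients of the square root series\<close>

text \<open>
  The function \<open>s(z) = 1 - sqrt(1 - z)\<close> satisfies \<open>s = (z + s\<^sup>2) / 2\<close>; comparing coefficients in this
  equation gives the recursion. Apart from the vanishing constant term, the coefficients are scaled
  Catalan numbers.
\<close>

fun sqrt_coeff :: "nat \<Rightarrow> real" where
  [simp del]: "sqrt_coeff n
     = ((if n = 1 then 1 else 0) + (\<Sum>i\<in>{0<..<n}. sqrt_coeff i * sqrt_coeff (n - i))) / 2"

lemma sqrt_coeff_rec:
  "2 * sqrt_coeff n
     = (if n = 1 then 1 else 0) + (\<Sum>i\<in>{0<..<n}. sqrt_coeff i * sqrt_coeff (n - i))"
  by (subst sqrt_coeff.simps) simp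

lemma sqrt_coeff_nonneg: "0 \<le> sqrt_coeff n"
proof (induction n rule: less_induct)
  case (less n)
  then show ?case by (subst sqrt_coeff.simps) (auto intro!: sum_nonneg add_nonneg_nonneg)
qed

lemma sqrt_coeff_zero: "sqrt_coeff 0 = 0"
  by (subst sqrt_coeff.simps) simp

lemma sqrt_coeff_convolution:
  "(\<Sum>i\<le>n. sqrt_coeff i * sqrt_coeff (n - i)) = 2 * sqrt_coeff n - (if n = 1 then 1 else 0)"
proof -
  have "(\<Sum>i\<le>n. sqrt_coeff i * sqrt_coeff (n - i))
      = (\<Sum>i\<in>{0<..<n}. sqrt_coeff i * sqrt_coeff (n - i))"
    by (rule sum.mono_neutral_right) (auto simp: sqrt_coeff_zero not_less)
  then show ?thesis using sqrt_coeff_rec[of n] by linarith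
qed

text \<open>
  Writing \<open>s\<^sub>N\<close> for the partial sums, the recursion gives \<open>2 s\<^sub>N\<^sub>+\<^sub>1 \<le> 1 + s\<^sub>N\<^sup>2\<close>, because the index pairs
  \<open>(i, j)\<close> with \<open>i, j > 0\<close> and \<open>i + j \<le> N + 1\<close> lie in the square \<open>{..N} \<times> {..N}\<close>. Hence \<open>s\<^sub>N \<le> 1\<close>
  propagates.
\<close>

lemma sum_sqrt_coeff_le: "(\<Sum>n\<le>N. sqrt_coeff n) \<le> 1"
proof (induction N)
  case 0
  then show ?case by (simp add: sqrt_coeff_zero)
next
  case (Suc N)
  let ?b = sqrt_coeff
  let ?D = "{(i, j). 0 < i \<and> 0 < j \<and> i + j \<le> Suc N}"
  have D: "?D \<subseteq> {..N} \<times> {..N}" by auto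
  have "2 * (\<Sum>n\<le>Suc N. ?b n)
      = (\<Sum>n\<le>Suc N. (if n = 1 then 1 else 0) + (\<Sum>i\<in>{0<..<n}. ?b i * ?b (n - i)))"
    unfolding sum_distrib_left sqrt_coeff_rec ..
  also have "\<dots> = 1 + (\<Sum>n\<le>Suc N. \<Sum>i\<in>{0<..<n}. ?b i * ?b (n - i))"
    by (simp add: sum.distrib)
  also have "(\<Sum>n\<le>Suc N. \<Sum>i\<in>{0<..<n}. ?b i * ?b (n - i))
      = (\<Sum>(n, i)\<in>Sigma {..Suc N} (\<lambda>n. {0<..<n}). ?b i * ?b (n - i))"
    by (subst sum.Sigma) auto
  also have "\<dots> = (\<Sum>(i, j)\<in>?D. ?b i * ?b j)"
    by (rule sum.reindex_bij_witness[of _ "\<lambda>(i, j). (i + j, i)" "\<lambda>(n, i). (i, n - i)"]) auto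
  also have "\<dots> \<le> (\<Sum>(i, j)\<in>{..N} \<times> {..N}. ?b i * ?b j)"
    by (rule sum_mono2) (use D in \<open>auto intro!: mult_nonneg_nonneg sqrt_coeff_nonneg\<close>)
  also have "\<dots> = (\<Sum>n\<le>N. ?b n)\<^sup>2"
    by (simp add: power2_eq_square sum_product sum.cartesian_product)
  also have "\<dots> \<le> 1"
    using Suc by (intro power_le_one sum_nonneg sqrt_coeff_nonneg) auto
  finally show ?case by simp
qed

lemma sum_sqrt_coeff_finite_le:
  assumes "finite F"
  shows "sum sqrt_coeff F \<le> 1"
proof -
  have "sum sqrt_coeff F \<le> (\<Sum>n\<le>Max F. sqrt_coeff n)"
    using assms by (intro sum_mono2) (auto intro: sqrt_coeff_nonneg)
  also have "\<dots> \<le> 1" by (rule sum_sqrt_coeff_le)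
  finally show ?thesis .
qed

lemma sqrt_coeff_summable: "sqrt_coeff summable_on UNIV"
  by (rule nonneg_bdd_above_summable_on)
    (auto intro!: sqrt_coeff_nonneg bdd_aboveI[where M = 1] sum_sqrt_coeff_finite_le)

lemma infsum_sqrt_coeff_le: "infsum sqrt_coeff UNIV \<le> 1"
  by (rule infsum_le_finite_sums[OF sqrt_coeff_summable]) (auto intro: sum_sqrt_coeff_finite_le)

text \<open>
  The rearrangement behind the Cauchy product, stated for a double family in a Banach space since it
  is applied to vectors \<open>b\<^sub>i b\<^sub>j A\<^sup>i\<^sup>+\<^sup>j x\<close>.
\<close>

lemma infsum_antidiagonal:
  fixes f :: "nat \<times> nat \<Rightarrow> 'b::banach"
  assumes "f summable_on UNIV"
  shows "(\<Sum>\<^sub>\<infinity>i. \<Sum>\<^sub>\<infinity>j. f (i, j)) = (\<Sum>\<^sub>\<infinity>n. \<Sum>i\<le>n. f (i, n - i))"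
proof -
  have bij: "bij_betw (\<lambda>(n, i). (i, n - i)) (Sigma UNIV (\<lambda>n::nat. {..n})) (UNIV \<times> UNIV)"
    by (rule bij_betw_byWitness[where f' = "\<lambda>(i, j). (i + j, i)"]) auto
  have f: "f summable_on (UNIV \<times> UNIV)" using assms by simp
  then have g: "(\<lambda>(n, i). f (i, n - i)) summable_on (Sigma UNIV (\<lambda>n::nat. {..n}))"
    using summable_on_reindex_bij_betw[OF bij, of f] by (simp add: case_prod_unfold)
  have "(\<Sum>\<^sub>\<infinity>i. \<Sum>\<^sub>\<infinity>j. f (i, j)) = infsum f (UNIV \<times> UNIV)"
    using infsum_Sigma_banach[OF f] by simp
  also have "\<dots> = infsum (\<lambda>(n, i). f (i, n - i)) (Sigma UNIV (\<lambda>n::nat. {..n}))"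
    using infsum_reindex_bij_betw[OF bij, of f] by (simp add: case_prod_unfold)
  also have "\<dots> = (\<Sum>\<^sub>\<infinity>n. \<Sum>\<^sub>\<infinity>i\<in>{..n}. f (i, n - i))"
    using infsum_Sigma_banach[OF g] by simp
  finally show ?thesis by simp
qed

context hilbert_space
begin

section \<open>Elementary geometry of the inner product\<close>

lemma ip_add_right: "ip z (x + y) = ip z x + ip z y"
  by (metis ip_add_left ip_commute rcnj_add)

lemma ip_scale_right: "ip x (scale c y) = rcnj c * ip x y"
  by (metis ip_scale_left ip_commute rcnj_mult)

lemma ip_scaleR_left: "ip (r *\<^sub>R x) y = of_real r * ip x y"
  by (metis ip_scale_left scale_of_real)

lemma ip_scaleR_right: "ip x (r *\<^sub>R y) = of_real r * ip x y"
  by (metis ip_scale_right scale_of_real rcnj_of_real)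

lemma ip_minus_left: "ip (- x) y = - ip x y"
  using ip_scaleR_left[of "-1" x y] by simp

lemma ip_minus_right: "ip x (- y) = - ip x y"
  using ip_scaleR_right[of x "-1" y] by simp

lemma ip_diff_left: "ip (x - y) z = ip x z - ip y z"
  using ip_add_left[of x "- y" z] by (simp add: ip_minus_left)

lemma ip_diff_right: "ip z (x - y) = ip z x - ip z y"
  using ip_add_right[of z x "- y"] by (simp add: ip_minus_right)

lemma ip_zero_left [simp]: "ip 0 y = 0"
  using ip_scaleR_left[of 0 0 y] by simp

lemma ip_zero_right [simp]: "ip x 0 = 0"
  using ip_scaleR_right[of x 0 0] by simp

lemma ip_sum_left: "ip (\<Sum>i\<in>A. f i) y = (\<Sum>i\<in>A. ip (f i) y)"
  by (induction A rule: infinite_finite_induct) (auto simp: ip_add_left)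

lemma ip_sum_right: "ip x (\<Sum>i\<in>A. f i) = (\<Sum>i\<in>A. ip x (f i))"
  by (induction A rule: infinite_finite_induct) (auto simp: ip_add_right)

lemma ip_eq_zero_sym: "ip x y = 0 \<Longrightarrow> ip y x = 0"
  by (metis ip_commute rcnj_zero)

abbreviation rip :: "'a \<Rightarrow> 'a \<Rightarrow> real" where
  "rip x y \<equiv> re_part (ip x y)"

lemma rip_self [simp]: "rip x x = (norm x)\<^sup>2"
  by (simp only: ip_self re_part_of_real)

lemma norm_ip_self: "norm (ip x x) = (norm x)\<^sup>2"
  by (simp only: ip_self norm_of_real abs_power2)

lemma rip_sym: "rip x y = rip y x"
  by (metis ip_commute re_part_rcnj)

lemma norm_add_sq: "(norm (x + y))\<^sup>2 = (norm x)\<^sup>2 + (norm y)\<^sup>2 + 2 * rip x y"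
proof -
  have "rip (x + y) (x + y) = rip x x + rip y y + 2 * rip x y"
    using rip_sym[of x y] by (simp only: ip_add_left ip_add_right re_part_add)
  then show ?thesis by (simp only: rip_self)
qed

lemma norm_diff_sq: "(norm (x - y))\<^sup>2 = (norm x)\<^sup>2 + (norm y)\<^sup>2 - 2 * rip x y"
  using norm_add_sq[of x "- y"] by (simp add: ip_minus_right re_part_minus)

lemma norm_scale: "norm (scale c x) = norm c * norm x"
proof -
  have "ip (scale c x) (scale c x) = (c * rcnj c) * ip x x"
    by (simp add: ip_scale_left ip_scale_right)
  then have "(of_real ((norm (scale c x))\<^sup>2) :: 'f) = of_real ((norm c * norm x)\<^sup>2)"
    unfolding mult_rcnj ip_self by (simp add: power_mult_distrib)
  then have "(norm (scale c x))\<^sup>2 = (norm c * norm x)\<^sup>2" unfolding of_real_eq_iff .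
  then show ?thesis by (simp add: power2_eq_iff_nonneg)
qed

lemma Cauchy_Schwarz: "norm (ip x y) \<le> norm x * norm y"
proof (cases "y = 0")
  case False
  define c where "c = ip x y * of_real (1 / (norm y)\<^sup>2)"
  have c: "c * ip y y = ip x y"
    using False by (simp add: c_def ip_self mult.assoc flip: of_real_mult)
  have "ip (x - scale c y) (scale c y) = 0"
    by (simp add: ip_scale_right ip_diff_left ip_scale_left c)
  then have "(norm x)\<^sup>2 = (norm (x - scale c y))\<^sup>2 + (norm (scale c y))\<^sup>2"
    using norm_add_sq[of "x - scale c y" "scale c y"] by simp
  then have "(norm (scale c y))\<^sup>2 \<le> (norm x)\<^sup>2" by simp
  then have "norm (scale c y) \<le> norm x" by (rule power2_le_imp_le) simp
  moreover have "norm (ip x y) = norm (scale c y) * norm y"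
    using arg_cong[OF c, of norm]
    by (simp add: norm_scale norm_mult norm_ip_self power2_eq_square mult.assoc)
  ultimately show ?thesis by (simp add: mult_right_mono)
qed simp

lemma rip_le: "rip x y \<le> norm x * norm y"
  using Cauchy_Schwarz[of x y] abs_re_part_le_norm[of "ip x y"] by linarith

lemma bounded_bilinear_ip: "bounded_bilinear ip"
  by (intro bounded_bilinear.intro exI[of _ 1])
    (simp_all add: ip_add_left ip_add_right ip_scaleR_left ip_scaleR_right scaleR_conv_of_real
      Cauchy_Schwarz)

lemma scale_scaleR_left: "scale (r *\<^sub>R c) x = r *\<^sub>R scale c x"
  by (metis scale_of_real scale_scale scaleR_conv_of_real)

lemma scale_scaleR_right: "scale c (r *\<^sub>R x) = r *\<^sub>R scale c x"
  by (metis scale_of_real scale_left_commute)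

lemma bounded_bilinear_scale: "bounded_bilinear scale"
  by (intro bounded_bilinear.intro exI[of _ 1])
    (simp_all add: scale_left_distrib scale_right_distrib scale_scaleR_left scale_scaleR_right
      norm_scale)

lemmas tendsto_ip = bounded_bilinear.tendsto[OF bounded_bilinear_ip]

lemma eq_if_ip_eq: "(\<And>x. ip x a = ip x b) \<Longrightarrow> a = b"
proof -
  assume "\<And>x. ip x a = ip x b"
  then have "ip (a - b) (a - b) = 0" by (simp add: ip_diff_right)
  then show "a = b" by (simp add: ip_self)
qed

text \<open>Testing against all scalar multiples recovers the full inner product from its real part.\<close>

lemma zero_if_re_part_mult:
  fixes z :: 'f
  assumes "\<And>c::'f. re_part (c * z) = 0"
  shows "z = 0"
proof -
  have "rcnj z * z = of_real ((norm z)\<^sup>2)" using mult_rcnj[of z] by (simp only: mult.commute)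
  then have "re_part (rcnj z * z) = (norm z)\<^sup>2" by (simp only: re_part_of_real)
  then show ?thesis using assms[of "rcnj z"] by simp
qed

section \<open>Representation of functionals\<close>

text \<open>
  A functional bounded by the seminorm \<open>\<parallel>P u\<parallel>\<close> factors through \<open>P\<close> as an inner product. The
  representing vector is the limit of \<open>P w\<^sub>n\<close> along a minimising sequence of
  \<open>J u = \<parallel>P u\<parallel>\<^sup>2 - 2 Re (\<phi> u)\<close>: the parallelogram identity makes \<open>P w\<^sub>n\<close> Cauchy, and the vanishing of
  the first variation of \<open>J\<close> is the representation.

  The map \<open>P\<close> is kept general because the different uses need it: with \<open>P\<close> the identity on the whole
  space or on a subspace this is the Riesz representation and the orthogonal projection, and with
  \<open>P = |T|\<close> it leads to the polar decomposition. The alternative \<open>v = 0\<close> covers a negative bound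
  \<open>K\<close>, which the hypotheses allow if \<open>P\<close> vanishes on \<open>S\<close>.
\<close>

lemma representation:
  fixes S :: "'b::real_vector set" and P :: "'b \<Rightarrow> 'a" and \<phi> :: "'b \<Rightarrow> 'f"
  assumes S0: "0 \<in> S" and S_add: "\<And>u w. u \<in> S \<Longrightarrow> w \<in> S \<Longrightarrow> u + w \<in> S"
    and S_sc: "\<And>c u. u \<in> S \<Longrightarrow> m c u \<in> S"
    and m_of_real: "\<And>r u. u \<in> S \<Longrightarrow> m (of_real r) u = r *\<^sub>R u"
    and P_add: "\<And>u w. u \<in> S \<Longrightarrow> w \<in> S \<Longrightarrow> P (u + w) = P u + P w"
    and P_sc: "\<And>c u. u \<in> S \<Longrightarrow> P (m c u) = scale c (P u)"
    and \<phi>_add: "\<And>u w. u \<in> S \<Longrightarrow> w \<in> S \<Longrightarrow> \<phi> (u + w) = \<phi> u + \<phi> w"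
    and \<phi>_sc: "\<And>c u. u \<in> S \<Longrightarrow> \<phi> (m c u) = c * \<phi> u"
    and bound: "\<And>u. u \<in> S \<Longrightarrow> norm (\<phi> u) \<le> K * norm (P u)"
  obtains v where "v \<in> closure (P ` S)" "norm v \<le> K \<or> v = 0" "\<And>u. u \<in> S \<Longrightarrow> \<phi> u = ip (P u) v"
proof -
  have PR: "P (r *\<^sub>R u) = r *\<^sub>R P u" "\<phi> (r *\<^sub>R u) = of_real r * \<phi> u" "r *\<^sub>R u \<in> S" if "u \<in> S" for r u
    using P_sc[OF that, of "of_real r"] \<phi>_sc[OF that, of "of_real r"] m_of_real[OF that]
      S_sc[OF that, of "of_real r"] by (simp_all add: scale_of_real)
  define J where "J u = (norm (P u))\<^sup>2 - 2 * re_part (\<phi> u)" for u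
  have low: "- K\<^sup>2 \<le> J u" if "u \<in> S" for u
  proof -
    have "re_part (\<phi> u) \<le> K * norm (P u)"
      using bound[OF that] abs_re_part_le_norm[of "\<phi> u"] by linarith
    then have "(norm (P u) - K)\<^sup>2 \<le> J u + K\<^sup>2"
      unfolding J_def by (simp add: power2_eq_square algebra_simps)
    then show ?thesis using zero_le_power2[of "norm (P u) - K"] by linarith
  qed
  have bdd: "bdd_below (J ` S)" using low by (rule bdd_belowI2)
  define \<mu> where "\<mu> = Inf (J ` S)"
  have \<mu>_le: "\<mu> \<le> J u" if "u \<in> S" for u
    unfolding \<mu>_def by (intro cInf_lower bdd imageI that)
  have "\<exists>u\<in>S. J u < \<mu> + 1 / real (Suc n)" for n
  proof -
    have "Inf (J ` S) < \<mu> + 1 / real (Suc n)" unfolding \<mu>_def by simp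
    then show ?thesis using cInf_less_iff[OF _ bdd] S0 by blast
  qed
  then obtain w where w: "\<And>n. w n \<in> S" "\<And>n. J (w n) < \<mu> + 1 / real (Suc n)" by metis
  have J_lim: "(\<lambda>n. J (w n)) \<longlonglongrightarrow> \<mu>"
  proof (rule tendsto_sandwich[where f = "\<lambda>_. \<mu>"])
    show "(\<lambda>n. \<mu> + 1 / real (Suc n)) \<longlonglongrightarrow> \<mu>"
      using tendsto_add[OF tendsto_const[of \<mu>] LIMSEQ_inverse_real_of_nat]
      by (simp add: inverse_eq_divide)
    show "\<forall>\<^sub>F n in sequentially. \<mu> \<le> J (w n)" by (intro always_eventually allI \<mu>_le w)
    show "\<forall>\<^sub>F n in sequentially. J (w n) \<le> \<mu> + 1 / real (Suc n)"
      by (intro always_eventually allI less_imp_le w)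
  qed simp
  \<comment> \<open>parallelogram identity; the midpoint of \<open>u\<close> and \<open>u'\<close> cannot lie below the infimum\<close>
  have par: "(norm (P u - P u'))\<^sup>2 \<le> 2 * (J u - \<mu>) + 2 * (J u' - \<mu>)" if "u \<in> S" "u' \<in> S" for u u'
  proof -
    have "J (c *\<^sub>R (u + u'))
        = c\<^sup>2 * (norm (P u + P u'))\<^sup>2 - 2 * c * (re_part (\<phi> u) + re_part (\<phi> u'))" for c
      using that unfolding J_def
      by (simp add: PR S_add P_add \<phi>_add re_part_of_real_mult re_part_add power_mult_distrib)
    from this[of "1/2"] have "J ((1/2) *\<^sub>R (u + u'))
        = (norm (P u + P u'))\<^sup>2 / 4 - re_part (\<phi> u) - re_part (\<phi> u')"
      by (simp add: power_divide)
    moreover have "\<mu> \<le> J ((1/2) *\<^sub>R (u + u'))" using that by (intro \<mu>_le PR S_add)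
    moreover have "(norm (P u - P u'))\<^sup>2 + (norm (P u + P u'))\<^sup>2
        = 2 * (norm (P u))\<^sup>2 + 2 * (norm (P u'))\<^sup>2"
      by (simp add: norm_add_sq norm_diff_sq)
    ultimately show ?thesis unfolding J_def by (simp add: field_simps)
  qed
  have "Cauchy (\<lambda>n. P (w n))"
  proof (rule metric_CauchyI)
    fix e :: real assume e: "e > 0"
    have "eventually (\<lambda>n. J (w n) < \<mu> + e\<^sup>2 / 4) sequentially"
      using e by (intro order_tendstoD(2)[OF J_lim]) simp
    then obtain N where N: "\<And>n. n \<ge> N \<Longrightarrow> J (w n) < \<mu> + e\<^sup>2 / 4"
      unfolding eventually_sequentially by blast
    show "\<exists>N. \<forall>i\<ge>N. \<forall>n\<ge>N. dist (P (w i)) (P (w n)) < e"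
    proof (intro exI allI impI)
      fix i n assume "N \<le> i" "N \<le> n"
      then have "J (w i) < \<mu> + e\<^sup>2 / 4" "J (w n) < \<mu> + e\<^sup>2 / 4" by (simp_all add: N)
      then have "(norm (P (w i) - P (w n)))\<^sup>2 < e\<^sup>2"
        using par[OF w(1)[of i] w(1)[of n]] by (simp add: field_simps)
      then show "dist (P (w i)) (P (w n)) < e"
        unfolding dist_norm using e by (intro power2_less_imp_less[of _ e]) auto
    qed
  qed
  then obtain v where v: "(\<lambda>n. P (w n)) \<longlonglongrightarrow> v"
    using Cauchy_convergent convergent_def by blast
  \<comment> \<open>first variation of \<open>J\<close> at the limit of the minimising sequence, in direction \<open>h\<close>\<close>
  have eq_re: "re_part (ip (P h) v - \<phi> h) = 0" if h: "h \<in> S" for h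
  proof -
    have "0 \<le> t * (2 * re_part (ip (P h) v - \<phi> h)) + t\<^sup>2 * (norm (P h))\<^sup>2" for t
    proof -
      have J_eq: "J (w n + t *\<^sub>R h)
          = J (w n) + t * (2 * re_part (ip (P h) (P (w n)) - \<phi> h)) + t\<^sup>2 * (norm (P h))\<^sup>2" for n
        unfolding J_def using h w(1)[of n] rip_sym[of "P (w n)" "P h"]
        by (simp add: P_add \<phi>_add PR norm_add_sq re_part_add re_part_of_real_mult re_part_diff
            ip_scaleR_right power_mult_distrib algebra_simps)
      have "(\<lambda>n. J (w n + t *\<^sub>R h)) \<longlonglongrightarrow>
          \<mu> + t * (2 * re_part (ip (P h) v - \<phi> h)) + t\<^sup>2 * (norm (P h))\<^sup>2"
        unfolding J_eq
        by (intro tendsto_intros J_lim bounded_linear.tendsto[OF bounded_linear_re_part] tendsto_ip v)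
      moreover have "\<mu> \<le> J (w n + t *\<^sub>R h)" for n by (intro \<mu>_le S_add w PR h)
      ultimately have "\<mu> \<le> \<mu> + t * (2 * re_part (ip (P h) v - \<phi> h)) + t\<^sup>2 * (norm (P h))\<^sup>2"
        by (intro LIMSEQ_le_const) auto
      then show ?thesis by simp
    qed
    then show ?thesis using quadratic_nonneg_imp_zero by fastforce
  qed
  have rep: "\<phi> h = ip (P h) v" if h: "h \<in> S" for h
  proof -
    have "re_part (c * (ip (P h) v - \<phi> h)) = 0" for c
      using eq_re[OF S_sc[OF h, of c]] h
      by (simp add: P_sc \<phi>_sc ip_scale_left right_diff_distrib)
    from zero_if_re_part_mult[OF this] show ?thesis by simp
  qed
  \<comment> \<open>the norm of \<open>v\<close> is bounded by testing the representation on the minimising sequence itself\<close>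
  have "(\<lambda>n. norm (ip (P (w n)) v)) \<longlonglongrightarrow> norm (ip v v)"
    by (intro tendsto_intros tendsto_ip v)
  moreover have "(\<lambda>n. K * norm (P (w n))) \<longlonglongrightarrow> K * norm v" by (intro tendsto_intros v)
  moreover have "norm (ip (P (w n)) v) \<le> K * norm (P (w n))" for n
    using bound[OF w(1)[of n]] rep[OF w(1)[of n]] by simp
  ultimately have "norm (ip v v) \<le> K * norm v" by (intro LIMSEQ_le) auto
  then have "norm v \<le> K \<or> v = 0" by (auto simp: norm_ip_self power2_eq_square mult_le_cancel_right)
  moreover have "v \<in> closure (P ` S)"
    unfolding closure_sequential using v w(1) by (intro exI[of _ "\<lambda>n. P (w n)"]) auto
  ultimately show thesis using that rep by blast
qed

section \<open>Operators and adjoints\<close>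

lemma bounded_opI:
  assumes "\<And>x y. T (x + y) = T x + T y" "\<And>c x. T (scale c x) = scale c (T x)"
    and "\<And>x. norm (T x) \<le> K * norm x"
  shows "bounded_op T"
proof -
  have "T (r *\<^sub>R x) = r *\<^sub>R T x" for r x using assms(2)[of "of_real r" x] by (simp add: scale_of_real)
  then show ?thesis unfolding bounded_op_def using assms
    by (intro conjI bounded_linear_intro[where K = K]) (auto simp: mult.commute)
qed

lemma bounded_op_add: "bounded_op T \<Longrightarrow> T (x + y) = T x + T y"
  unfolding bounded_op_def by (simp add: linear_simps)

lemma bounded_op_diff: "bounded_op T \<Longrightarrow> T (x - y) = T x - T y"
  unfolding bounded_op_def by (simp add: linear_simps)

lemma bounded_op_scale: "bounded_op T \<Longrightarrow> T (scale c x) = scale c (T x)"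
  unfolding bounded_op_def by simp

lemma bounded_op_scaleR: "bounded_op T \<Longrightarrow> T (r *\<^sub>R x) = r *\<^sub>R T x"
  unfolding bounded_op_def by (simp add: linear_simps)

lemma bounded_op_linear: "bounded_op T \<Longrightarrow> bounded_linear T"
  unfolding bounded_op_def by simp

lemma bounded_op_zero: "bounded_op T \<Longrightarrow> T 0 = 0"
  unfolding bounded_op_def by (simp add: linear_simps)

lemma bounded_op_norm_le: "bounded_op T \<Longrightarrow> norm (T x) \<le> onorm T * norm x"
  by (intro onorm bounded_op_linear)

lemma bounded_op_id: "bounded_op (\<lambda>x. x)"
  by (rule bounded_opI[where K = 1]) auto

lemma bounded_op_comp: "bounded_op S \<Longrightarrow> bounded_op T \<Longrightarrow> bounded_op (S \<circ> T)"
  unfolding bounded_op_def o_def by (auto intro: bounded_linear_compose)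

lemma subspace_range:
  assumes T: "bounded_op T"
  shows "subspace (range T)"
proof (rule subspaceI)
  show "0 \<in> range T" using bounded_op_zero[OF T] by (metis rangeI)
qed (auto simp flip: bounded_op_add[OF T] bounded_op_scale[OF T])

lemma subspace_closure:
  assumes "subspace M"
  shows "subspace (closure M)"
proof (rule subspaceI)
  show "0 \<in> closure M" using subspace_0[OF assms] closure_subset by blast
next
  fix x y assume "x \<in> closure M" "y \<in> closure M"
  then obtain u w where "\<And>n. u n \<in> M" "u \<longlonglongrightarrow> x" "\<And>n. w n \<in> M" "w \<longlonglongrightarrow> y"
    unfolding closure_sequential by blast
  then show "x + y \<in> closure M" unfolding closure_sequential
    by (intro exI[of _ "\<lambda>n. u n + w n"]) (auto intro: tendsto_add subspace_add[OF assms])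
next
  fix c x assume "x \<in> closure M"
  then obtain u where "\<And>n. u n \<in> M" "u \<longlonglongrightarrow> x" unfolding closure_sequential by blast
  then show "scale c x \<in> closure M" unfolding closure_sequential
    by (intro exI[of _ "\<lambda>n. scale c (u n)"])
      (auto intro: bounded_bilinear.tendsto[OF bounded_bilinear_scale] subspace_scale[OF assms])
qed

lemma orthogonal_closure:
  assumes "\<And>m. m \<in> M \<Longrightarrow> ip m v = 0" and "x \<in> closure M"
  shows "ip x v = 0"
proof -
  obtain u where u: "\<And>n. u n \<in> M" "u \<longlonglongrightarrow> x" using assms(2) unfolding closure_sequential by blast
  have "(\<lambda>n. ip (u n) v) \<longlonglongrightarrow> ip x v" by (intro tendsto_ip u tendsto_const)
  then show ?thesis using assms(1)[OF u(1)] by (simp add: LIMSEQ_const_iff)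
qed

text \<open>Uniqueness of representing vectors, provided that they lie in the closure of the test space.\<close>

lemma eq_in_closure_if_ip_eq:
  assumes "subspace M" "v \<in> closure M" "w \<in> closure M" and eq: "\<And>m. m \<in> M \<Longrightarrow> ip m v = ip m w"
  shows "v = w"
proof -
  have "v - w \<in> closure M" using subspace_diff[OF subspace_closure] assms by blast
  then have "ip (v - w) (v - w) = 0"
    by (rule orthogonal_closure[rotated]) (simp add: ip_diff_right eq)
  then show ?thesis by (simp add: ip_self)
qed

text \<open>
  Douglas' factorization in adjoint form: \<open>T\<^sup>* = P\<^sup>* V\<close>. Each value \<open>V y\<close> represents the functional
  \<open>P x \<mapsto> \<langle>T x; y\<rangle>\<close>, and choosing it in the closure of the range of \<open>P\<close> makes it unique, hence \<open>V\<close>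
  linear. The case \<open>P = 1\<close> is the existence of the adjoint.
\<close>

lemma factorization:
  assumes P: "bounded_op P" and T: "bounded_op T" and le: "\<And>x. norm (T x) \<le> K * norm (P x)"
    and K: "0 \<le> K"
  obtains V where "bounded_op V" "\<And>y. norm (V y) \<le> K * norm y" "\<And>y. V y \<in> closure (range P)"
    "\<And>x y. ip (T x) y = ip (P x) (V y)"
proof -
  have "\<exists>v. v \<in> closure (range P) \<and> norm v \<le> K * norm y \<and> (\<forall>x. ip (T x) y = ip (P x) v)" for y
  proof -
    have bound: "norm (ip (T x) y) \<le> (K * norm y) * norm (P x)" for x
      using Cauchy_Schwarz[of "T x" y] mult_right_mono[OF le[of x] norm_ge_zero[of y]]
      by (simp add: mult_ac)
    show ?thesis
      by (rule representation[of UNIV scale P "\<lambda>x. ip (T x) y" "K * norm y"])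
        (use bound K in \<open>auto simp: bounded_op_add[OF P] bounded_op_add[OF T] bounded_op_scale[OF P]
          bounded_op_scale[OF T] ip_add_left ip_scale_left scale_of_real\<close>)
  qed
  then obtain V where V: "\<And>y. V y \<in> closure (range P)" "\<And>y. norm (V y) \<le> K * norm y"
    "\<And>x y. ip (T x) y = ip (P x) (V y)" by metis
  note sub = subspace_closure[OF subspace_range[OF P]]
  have "bounded_op V"
  proof (rule bounded_opI[OF _ _ V(2)])
    fix x y c
    show "V (x + y) = V x + V y"
      by (rule eq_in_closure_if_ip_eq[OF subspace_range[OF P]])
        (auto simp: V(1) subspace_add[OF sub] ip_add_right simp flip: V(3))
    show "V (scale c x) = scale c (V x)"
      by (rule eq_in_closure_if_ip_eq[OF subspace_range[OF P]])
        (auto simp: V(1) subspace_scale[OF sub] ip_scale_right simp flip: V(3))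
  qed
  then show thesis using that V by blast
qed

lemma adj_eqI: "(\<And>x y. ip (T x) y = ip x (S y)) \<Longrightarrow> adj T = S"
  unfolding adj_def by (rule the_equality) (auto intro: eq_if_ip_eq)

lemma adjoint:
  assumes T: "bounded_op T"
  shows "bounded_op (adj T)" "ip (T x) y = ip x (adj T y)" "ip (adj T x) y = ip x (T y)"
    "norm (adj T x) \<le> onorm T * norm x"
proof -
  obtain S where S: "bounded_op S" "\<And>y. norm (S y) \<le> onorm T * norm y"
    "\<And>x y. ip (T x) y = ip x (S y)"
    using factorization[OF bounded_op_id T bounded_op_norm_le[OF T] onorm_pos_le[OF bounded_op_linear[OF T]]]
    by metis
  have "adj T = S" using S(3) by (rule adj_eqI)
  then show "bounded_op (adj T)" "ip (T x) y = ip x (adj T y)" "ip (adj T x) y = ip x (T y)"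
    "norm (adj T x) \<le> onorm T * norm x"
    using S ip_commute by metis+
qed

text \<open>
  Nonnegativity without the definite description in \<^const>\<open>adj\<close> and with real values of the quadratic
  form, which is the shape that the arguments below work with.
\<close>

definition positive_op :: "('a \<Rightarrow> 'a) \<Rightarrow> bool" where
  "positive_op T \<longleftrightarrow> bounded_op T \<and> (\<forall>x y. ip (T x) y = ip x (T y)) \<and> (\<forall>x. 0 \<le> rip (T x) x)"

lemma positiveD:
  assumes "positive_op T"
  shows "bounded_op T" "ip (T x) y = ip x (T y)" "0 \<le> rip (T x) x"
  using assms unfolding positive_op_def by auto

lemma positive_ip:
  assumes "positive_op T"
  shows "ip (T x) x = of_real (rip (T x) x)"
  using assms ip_commute[of "T x" x] unfolding positive_op_def
  by (intro of_real_re_part_if_fixed[symmetric]) simp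

lemma nonneg_op_iff_positive: "nonneg_op T \<longleftrightarrow> positive_op T"
proof
  assume T: "nonneg_op T"
  have "0 \<le> rip (T x) x" for x
  proof -
    have "ip (T x) x \<in> \<real>\<^sub>\<ge>\<^sub>0" using T unfolding nonneg_op_def by blast
    then obtain r where "ip (T x) x = of_real r" "0 \<le> r" by (rule nonneg_Reals_cases)
    then show ?thesis by simp
  qed
  then show "positive_op T"
    using T adjoint(2)[of T] unfolding positive_op_def nonneg_op_def by auto
next
  assume T: "positive_op T"
  then have "adj T = T" unfolding positive_op_def by (intro adj_eqI) auto
  moreover have "ip (T x) x \<in> \<real>\<^sub>\<ge>\<^sub>0" for x
    using positiveD(3)[OF T, of x] by (subst positive_ip[OF T]) simp
  ultimately show "nonneg_op T" using T unfolding nonneg_op_def positive_op_def by auto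
qed

text \<open>
  The quadratic form is minimal at \<open>x\<close>, so its first variation in the direction of \<open>T x\<close>, which is
  a multiple of \<open>\<parallel>T x\<parallel>\<^sup>2\<close>, vanishes.
\<close>

lemma positive_zero_if_form_zero:
  assumes T: "positive_op T" and 0: "rip (T x) x = 0"
  shows "T x = 0"
proof -
  have "0 \<le> t * (- 2 * (norm (T x))\<^sup>2) + t\<^sup>2 * rip (T (T x)) (T x)" for t
  proof -
    have "rip (T (x - t *\<^sub>R T x)) (x - t *\<^sub>R T x)
        = rip (T x) x - 2 * t * (norm (T x))\<^sup>2 + t\<^sup>2 * rip (T (T x)) (T x)"
      unfolding bounded_op_diff[OF positiveD(1)[OF T]] bounded_op_scaleR[OF positiveD(1)[OF T]]
          ip_diff_left ip_diff_right ip_scaleR_left ip_scaleR_right re_part_diff re_part_of_real_mult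
          positiveD(2)[OF T, of "T x" x] rip_self
      by (simp add: power2_eq_square algebra_simps)
    then show ?thesis using positiveD(3)[OF T, of "x - t *\<^sub>R T x"] 0 by simp
  qed
  from quadratic_nonneg_imp_zero[OF this] show ?thesis by simp
qed

section \<open>Square roots and absolute values\<close>

text \<open>
  For a contraction \<open>A\<close> this is \<open>1 - sqrt(1 - A)\<close>. The series converges absolutely at each vector.
\<close>

definition sqrt_series :: "('a \<Rightarrow> 'a) \<Rightarrow> 'a \<Rightarrow> 'a" where
  "sqrt_series A x = (\<Sum>\<^sub>\<infinity>n. sqrt_coeff n *\<^sub>R (A ^^ n) x)"

context
  fixes A :: "'a \<Rightarrow> 'a"
  assumes A: "bounded_op A" and contraction: "\<And>x. norm (A x) \<le> norm x"
begin

lemma bounded_op_funpow: "bounded_op (A ^^ n)"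
  by (induction n)
    (auto simp: id_def o_def bounded_op_id intro: bounded_op_comp[OF A, unfolded o_def])

lemma norm_funpow_le: "norm ((A ^^ n) x) \<le> norm x"
  by (induction n) (auto intro: order_trans[OF contraction])

lemma sqrt_series_summable:
  "(\<lambda>n. norm (sqrt_coeff n *\<^sub>R (A ^^ n) x)) summable_on UNIV"
  "(\<lambda>n. sqrt_coeff n *\<^sub>R (A ^^ n) x) summable_on UNIV"
proof -
  show *: "(\<lambda>n. norm (sqrt_coeff n *\<^sub>R (A ^^ n) x)) summable_on UNIV"
    by (rule summable_on_comparison_test[OF summable_on_cmult_left[OF sqrt_coeff_summable, of "norm x"]])
      (auto simp: sqrt_coeff_nonneg intro!: mult_left_mono norm_funpow_le)
  show "(\<lambda>n. sqrt_coeff n *\<^sub>R (A ^^ n) x) summable_on UNIV"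
    using * by (rule abs_summable_summable)
qed

lemma sqrt_series_apply:
  assumes "bounded_linear h"
  shows "h (sqrt_series A x) = (\<Sum>\<^sub>\<infinity>n. sqrt_coeff n *\<^sub>R h ((A ^^ n) x))"
proof -
  have "((\<lambda>n. h (sqrt_coeff n *\<^sub>R (A ^^ n) x)) has_sum h (sqrt_series A x)) UNIV"
    unfolding sqrt_series_def
    using has_sum_bounded_linear[OF assms has_sum_infsum[OF sqrt_series_summable(2)[of x]]] by (simp add: o_def)
  then show ?thesis by (simp add: linear_simps[OF assms] infsumI)
qed

lemma norm_sqrt_series_le: "norm (sqrt_series A x) \<le> norm x"
proof -
  have "norm (sqrt_series A x) \<le> (\<Sum>\<^sub>\<infinity>n. norm (sqrt_coeff n *\<^sub>R (A ^^ n) x))"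
    unfolding sqrt_series_def by (rule norm_infsum_bound[OF sqrt_series_summable(1)])
  also have "\<dots> \<le> (\<Sum>\<^sub>\<infinity>n. sqrt_coeff n * norm x)"
    by (rule infsum_mono[OF sqrt_series_summable(1) summable_on_cmult_left[OF sqrt_coeff_summable]])
      (auto simp: sqrt_coeff_nonneg intro!: mult_left_mono norm_funpow_le)
  also have "\<dots> = infsum sqrt_coeff UNIV * norm x" by (rule infsum_cmult_left')
  also have "\<dots> \<le> norm x" using infsum_sqrt_coeff_le by (simp add: mult_left_le_one_le infsum_nonneg sqrt_coeff_nonneg)
  finally show ?thesis .
qed

lemma bounded_op_sqrt_series: "bounded_op (sqrt_series A)"
proof (rule bounded_opI[where K = 1])
  fix x y c
  show "sqrt_series A (x + y) = sqrt_series A x + sqrt_series A y"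
    unfolding sqrt_series_def
    by (simp add: bounded_op_add[OF bounded_op_funpow] scaleR_add_right infsum_add sqrt_series_summable)
  have "bounded_linear (scale c)"
    by (rule bounded_bilinear.bounded_linear_right[OF bounded_bilinear_scale])
  then show "sqrt_series A (scale c x) = scale c (sqrt_series A x)"
    by (subst sqrt_series_apply) (simp_all add: sqrt_series_def bounded_op_scale[OF bounded_op_funpow])
qed (simp add: norm_sqrt_series_le)

lemma sqrt_series_commute:
  assumes C: "bounded_op C" and comm: "\<And>x. C (A x) = A (C x)"
  shows "C (sqrt_series A x) = sqrt_series A (C x)"
proof -
  have "C ((A ^^ n) x) = (A ^^ n) (C x)" for n by (induction n) (simp_all add: comm)
  then show ?thesis
    unfolding sqrt_series_apply[OF bounded_op_linear[OF C]] by (simp add: sqrt_series_def)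
qed

lemma sqrt_series_symmetric:
  assumes sym: "\<And>x y. ip (A x) y = ip x (A y)"
  shows "ip (sqrt_series A x) y = ip x (sqrt_series A y)"
proof -
  have pow: "ip ((A ^^ n) x) y = ip x ((A ^^ n) y)" for n
  proof (induction n arbitrary: x)
    case (Suc n)
    show ?case unfolding funpow_Suc_right[of n A] o_def Suc
      by (simp add: sym flip: funpow_swap1)
  qed simp
  note bl = bounded_bilinear.bounded_linear_left[OF bounded_bilinear_ip]
    bounded_bilinear.bounded_linear_right[OF bounded_bilinear_ip]
  show ?thesis by (simp add: sqrt_series_apply[OF bl(1)] sqrt_series_apply[OF bl(2)] pow)
qed

text \<open>The equation \<open>s\<^sup>2 = 2 s - z\<close> of the scalar series, transferred by the Cauchy product.\<close>

lemma sqrt_series_square: "sqrt_series A (sqrt_series A x) = 2 *\<^sub>R sqrt_series A x - A x"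
proof -
  define f where "f = (\<lambda>(i, j). (sqrt_coeff i * sqrt_coeff j) *\<^sub>R (A ^^ (i + j)) x)"
  have "(\<lambda>p. norm (f p)) summable_on UNIV \<times> UNIV"
  proof (rule summable_on_comparison_test)
    have "(\<lambda>p. norm ((\<lambda>(i, j). sqrt_coeff i * (sqrt_coeff j * norm x)) p)) summable_on UNIV \<times> UNIV"
      by (subst Infinite_Sum.abs_summable_on_Sigma_iff)
        (simp add: sqrt_coeff_nonneg abs_mult infsum_cmult_right' infsum_cmult_left'
          infsum_nonneg summable_on_cmult_left summable_on_cmult_right sqrt_coeff_summable)
    then show "(\<lambda>(i, j). sqrt_coeff i * (sqrt_coeff j * norm x)) summable_on UNIV \<times> UNIV"
      by (rule abs_summable_summable)
  qed (auto simp: f_def sqrt_coeff_nonneg mult.assoc intro!: mult_left_mono norm_funpow_le)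
  then have "(\<lambda>p. norm (f p)) summable_on UNIV" by simp
  then have f: "f summable_on UNIV" by (rule abs_summable_summable)
  have "sqrt_series A (sqrt_series A x) = (\<Sum>\<^sub>\<infinity>i. \<Sum>\<^sub>\<infinity>j. f (i, j))"
    unfolding sqrt_series_def[of A "sqrt_series A x"]
    by (simp add: sqrt_series_apply[OF bounded_op_linear[OF bounded_op_funpow]] f_def funpow_add
        infsum_scaleR_right flip: scaleR_scaleR)
  also have "\<dots> = (\<Sum>\<^sub>\<infinity>n. \<Sum>i\<le>n. f (i, n - i))" by (rule infsum_antidiagonal[OF f])
  also have "\<dots> = (\<Sum>\<^sub>\<infinity>n. 2 *\<^sub>R (sqrt_coeff n *\<^sub>R (A ^^ n) x) + (if n = 1 then - A x else 0))"
  proof (rule infsum_cong)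
    fix n
    have "(\<Sum>i\<le>n. f (i, n - i)) = (\<Sum>i\<le>n. sqrt_coeff i * sqrt_coeff (n - i)) *\<^sub>R (A ^^ n) x"
      by (simp add: f_def scaleR_sum_left)
    then show "(\<Sum>i\<le>n. f (i, n - i)) = 2 *\<^sub>R (sqrt_coeff n *\<^sub>R (A ^^ n) x) + (if n = 1 then - A x else 0)"
      unfolding sqrt_coeff_convolution by (simp add: scaleR_diff_left)
  qed
  also have "\<dots> = 2 *\<^sub>R sqrt_series A x - A x"
  proof -
    have "((\<lambda>n::nat. if n = 1 then - A x else 0) has_sum - A x) UNIV
        \<longleftrightarrow> ((\<lambda>_. - A x) has_sum - A x) {1::nat}"
      by (rule has_sum_cong_neutral) auto
    moreover have "((\<lambda>_. - A x) has_sum - A x) {1::nat}"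
      using has_sum_finite[of "{1::nat}" "\<lambda>_. - A x"] by simp
    moreover have "((\<lambda>n. 2 *\<^sub>R (sqrt_coeff n *\<^sub>R (A ^^ n) x)) has_sum 2 *\<^sub>R sqrt_series A x) UNIV"
      unfolding sqrt_series_def
      using has_sum_bounded_linear[OF bounded_linear_scaleR_right[of 2]
          has_sum_infsum[OF sqrt_series_summable(2)[of x]]] by (simp only: o_def)
    ultimately have "((\<lambda>n. 2 *\<^sub>R (sqrt_coeff n *\<^sub>R (A ^^ n) x) + (if n = 1 then - A x else 0))
        has_sum (2 *\<^sub>R sqrt_series A x + - A x)) UNIV" by (intro has_sum_add) blast+
    then show ?thesis by (simp add: infsumI)
  qed
  finally show ?thesis .
qed

end

text \<open>
  Scaling \<open>T\<close> down to \<open>B = T / c\<close> with \<open>0 \<le> B \<le> 1\<close> makes \<open>A = 1 - B\<close> a contraction, so that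
  \<open>sqrt T = sqrt c \<cdot> sqrt(1 - A)\<close> is given by the series. As a limit of polynomials in \<open>T\<close> it commutes
  with every bounded operator that commutes with \<open>T\<close>; this is recorded because uniqueness depends on it.
\<close>

lemma square_root_exists:
  assumes T: "positive_op T"
  obtains R where "positive_op R" "R \<circ> R = T"
    "\<And>C x. bounded_op C \<Longrightarrow> (\<And>x. C (T x) = T (C x)) \<Longrightarrow> C (R x) = R (C x)"
proof -
  note bT = positiveD(1)[OF T]
  \<comment> \<open>the summand 1 keeps \<open>c\<close> positive for \<open>T = 0\<close>\<close>
  define c where "c = onorm T + 1"
  have c: "c > 0" "onorm T \<le> c"
    using onorm_pos_le[OF bounded_op_linear[OF bT]] by (auto simp: c_def)
  define B where "B x = (1 / c) *\<^sub>R T x" for x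
  define A where "A x = x - B x" for x
  have B_norm: "norm (B x) \<le> norm x" for x
  proof -
    have "norm (T x) \<le> c * norm x"
      using bounded_op_norm_le[OF bT, of x] mult_right_mono[OF c(2) norm_ge_zero[of x]] by simp
    then show ?thesis using c by (simp add: B_def field_simps)
  qed
  have B: "bounded_op B"
    by (rule bounded_opI[where K = 1])
      (use B_norm in \<open>auto simp: B_def bounded_op_add[OF bT] bounded_op_scale[OF bT] scaleR_add_right
        scale_scaleR_right\<close>)
  have B_sym: "ip (B x) y = ip x (B y)" for x y
    by (simp add: B_def ip_scaleR_left ip_scaleR_right positiveD(2)[OF T] del: of_real_divide)
  have B_pos: "0 \<le> rip (B x) x" for x
    unfolding B_def ip_scaleR_left re_part_of_real_mult using positiveD(3)[OF T, of x] c by simp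
  \<comment> \<open>\<open>B\<^sup>2 \<le> B\<close>, by testing the positivity of \<open>B\<close> on \<open>x - B x\<close>; it makes \<open>A\<close> a contraction\<close>
  have B_sq: "(norm (B x))\<^sup>2 \<le> rip (B x) x" for x
  proof -
    have "rip (B (x - B x)) (x - B x) = rip (B x) x - 2 * (norm (B x))\<^sup>2 + rip (B (B x)) (B x)"
      unfolding bounded_op_diff[OF B] ip_diff_left ip_diff_right re_part_diff B_sym[of "B x" x]
        rip_self by simp
    moreover have "rip (B (B x)) (B x) \<le> (norm (B x))\<^sup>2"
      using rip_le[of "B (B x)" "B x"] mult_right_mono[OF B_norm[of "B x"] norm_ge_zero[of "B x"]]
      by (simp add: power2_eq_square)
    ultimately show ?thesis using B_pos[of "x - B x"] by simp
  qed
  have A: "bounded_op A"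
  proof (rule bounded_opI)
    fix x
    show "norm (A x) \<le> 2 * norm x"
      using norm_triangle_ineq4[of x "B x"] B_norm[of x] by (simp add: A_def)
  qed (simp_all add: A_def bounded_op_add[OF B] bounded_op_scale[OF B] scale_right_diff_distrib)
  have A_norm: "norm (A x) \<le> norm x" for x
  proof -
    have "(norm (A x))\<^sup>2 \<le> (norm x)\<^sup>2"
      unfolding A_def norm_diff_sq using B_sq[of x] B_pos[of x] rip_sym[of x "B x"] by simp
    then show ?thesis by (rule power2_le_imp_le) simp
  qed
  have A_sym: "ip (A x) y = ip x (A y)" for x y
    by (simp add: A_def ip_diff_left ip_diff_right B_sym)
  let ?S = "sqrt_series A"
  define R where "R x = sqrt c *\<^sub>R (x - ?S x)" for x
  note S = bounded_op_sqrt_series[OF A A_norm] norm_sqrt_series_le[OF A A_norm]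
  have R: "bounded_op R"
  proof (rule bounded_opI)
    fix x
    have "norm (x - ?S x) \<le> 2 * norm x" using norm_triangle_ineq4[of x "?S x"] S(2)[of x] by simp
    then show "norm (R x) \<le> (sqrt c * 2) * norm x"
      using c by (simp add: R_def mult.assoc)
  qed (simp_all add: R_def bounded_op_add[OF S(1)] bounded_op_scale[OF S(1)] scale_scaleR_right
      scale_right_diff_distrib algebra_simps)
  have "positive_op R"
    unfolding positive_op_def
  proof (intro conjI allI R)
    fix x y
    show "ip (R x) y = ip x (R y)"
      unfolding R_def ip_scaleR_left ip_scaleR_right ip_diff_left ip_diff_right
      by (simp add: sqrt_series_symmetric[OF A A_norm A_sym])
    have "rip (?S x) x \<le> (norm x)\<^sup>2"
      using rip_le[of "?S x" x] mult_right_mono[OF S(2)[of x] norm_ge_zero[of x]]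
      by (simp add: power2_eq_square)
    then show "0 \<le> rip (R x) x"
      unfolding R_def ip_scaleR_left ip_diff_left re_part_of_real_mult re_part_diff rip_self
      using c by simp
  qed
  moreover have "R \<circ> R = T"
  proof
    fix x
    have "?S (?S x) = 2 *\<^sub>R ?S x - A x" by (rule sqrt_series_square[OF A A_norm])
    then have "(x - ?S x) - (?S x - ?S (?S x)) = x - A x" by (simp add: scaleR_2)
    moreover have "(R \<circ> R) x = (sqrt c * sqrt c) *\<^sub>R ((x - ?S x) - (?S x - ?S (?S x)))"
      by (simp add: R_def bounded_op_diff[OF S(1)] bounded_op_scaleR[OF S(1)] scaleR_diff_right)
    ultimately have "(R \<circ> R) x = (sqrt c * sqrt c) *\<^sub>R (x - A x)" by (simp only:)
    then show "(R \<circ> R) x = T x" using c by (simp add: A_def B_def)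
  qed
  moreover have "C (R x) = R (C x)" if C: "bounded_op C" and comm: "\<And>x. C (T x) = T (C x)" for C x
  proof -
    have "C (A x) = A (C x)" for x
      by (simp add: A_def B_def bounded_op_diff[OF C] bounded_op_scaleR[OF C] comm)
    then show ?thesis
      by (simp add: R_def bounded_op_diff[OF C] bounded_op_scaleR[OF C]
          sqrt_series_commute[OF A A_norm C])
  qed
  ultimately show thesis using that by blast
qed

text \<open>
  For commuting square roots and \<open>y = R x - S x\<close> one has \<open>(R + S) y = (R\<^sup>2 - S\<^sup>2) x = 0\<close>. Then the two
  nonnegative numbers \<open>\<langle>R y; y\<rangle>\<close> and \<open>\<langle>S y; y\<rangle>\<close> vanish, so \<open>R y = S y = 0\<close> and
  \<open>\<parallel>y\<parallel>\<^sup>2 = \<langle>x; (R - S) y\<rangle> = 0\<close>.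
\<close>

lemma square_root_unique:
  assumes R: "positive_op R" and S: "positive_op S" and eq: "R \<circ> R = S \<circ> S"
    and comm: "\<And>x. S (R x) = R (S x)"
  shows "R = S"
proof
  fix x
  note bR = positiveD(1)[OF R] and bS = positiveD(1)[OF S]
  define y where "y = R x - S x"
  have "R (R x) = S (S x)" using eq by (metis comp_apply)
  then have "R y + S y = 0"
    by (simp add: y_def bounded_op_diff[OF bR] bounded_op_diff[OF bS] comm)
  then have "rip (R y) y + rip (S y) y = 0" by (simp flip: ip_add_left re_part_add)
  then have "rip (R y) y = 0" "rip (S y) y = 0"
    using positiveD(3)[OF R, of y] positiveD(3)[OF S, of y] by auto
  then have "R y = 0" "S y = 0"
    using positive_zero_if_form_zero[OF R] positive_zero_if_form_zero[OF S] by auto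
  then have "ip y y = 0"
    unfolding y_def[of ] ip_diff_left positiveD(2)[OF R] positiveD(2)[OF S] by (simp flip: y_def)
  then show "R x = S x" by (simp add: ip_self y_def)
qed

text \<open>
  Any square root \<open>S\<close> of \<open>T\<close> commutes with \<open>T = S\<^sup>2\<close>, hence with the one given by the series, and so
  agrees with it.
\<close>

lemma sqrt_op:
  assumes T: "positive_op T"
  shows "positive_op (sqrt_op T)" "sqrt_op T (sqrt_op T x) = T x"
proof -
  obtain R where R: "positive_op R" "R \<circ> R = T"
    and comm: "\<And>C x. bounded_op C \<Longrightarrow> (\<And>x. C (T x) = T (C x)) \<Longrightarrow> C (R x) = R (C x)"
    using square_root_exists[OF T] by blast
  have "sqrt_op T = R" unfolding sqrt_op_def
  proof (rule the_equality)
    show "nonneg_op R \<and> R \<circ> R = T" using R by (simp add: nonneg_op_iff_positive)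
    fix S assume S: "nonneg_op S \<and> S \<circ> S = T"
    then have pS: "positive_op S" by (simp add: nonneg_op_iff_positive)
    have "S (T x) = T (S x)" for x using S by (metis comp_apply)
    then have "S (R x) = R (S x)" for x by (intro comm positiveD(1)[OF pS])
    then show "S = R" using square_root_unique[OF R(1) pS] R(2) S by simp
  qed
  then show "positive_op (sqrt_op T)" "sqrt_op T (sqrt_op T x) = T x"
    using R(1) fun_cong[OF R(2), of x] by simp_all
qed

lemma abs_op:
  assumes T: "bounded_op T"
  shows "positive_op (abs_op T)" "norm (abs_op T x) = norm (T x)"
    "abs_op T (abs_op T x) = adj T (T x)"
proof -
  have "positive_op (adj T \<circ> T)"
    unfolding positive_op_def using bounded_op_comp[OF adjoint(1)[OF T] T]
    by (auto simp: adjoint(3)[OF T] simp flip: adjoint(2)[OF T])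
  note P = sqrt_op[OF this, folded abs_op_def]
  then show "positive_op (abs_op T)" "abs_op T (abs_op T x) = adj T (T x)" by auto
  have "ip (abs_op T x) (abs_op T x) = ip (T x) (T x)"
    using P(2)[of x] by (simp add: positiveD(2)[OF P(1)] adjoint(2)[OF T])
  then have "(norm (abs_op T x))\<^sup>2 = (norm (T x))\<^sup>2" by (metis rip_self)
  then show "norm (abs_op T x) = norm (T x)" by (simp add: power2_eq_iff_nonneg)
qed

lemma eq_if_ip_eq_left:
  assumes "\<And>y. ip a y = ip b y"
  shows "a = b"
proof (rule eq_if_ip_eq)
  fix x show "ip x a = ip x b" using assms[of x] by (simp only: ip_commute[of x a] ip_commute[of x b])
qed

text \<open>
  Since \<open>\<parallel>T x\<parallel> = \<parallel>|T| x\<parallel>\<close>, factorization of \<open>T\<close> through \<open>|T|\<close> with constant 1 yields \<open>V\<close>, and \<open>W\<close> is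
  its adjoint.
\<close>

lemma polar_decomposition:
  assumes T: "bounded_op T"
  obtains V W where "bounded_op V" "\<And>x. norm (V x) \<le> norm x" "\<And>x. V (T x) = abs_op T x"
    "bounded_op W" "\<And>x. norm (W x) \<le> norm x" "\<And>x. W (abs_op T x) = T x"
proof -
  let ?P = "abs_op T"
  note P = positiveD[OF abs_op(1)[OF T]]
  obtain V where V: "bounded_op V" "\<And>y. norm (V y) \<le> 1 * norm y"
      "\<And>y. V y \<in> closure (range ?P)" "\<And>x y. ip (T x) y = ip (?P x) (V y)"
    by (rule factorization[OF P(1) T, where K = 1]) (simp_all add: abs_op(2)[OF T])
  have VT: "V (T x) = ?P x" for x
  proof (rule eq_in_closure_if_ip_eq[OF subspace_range[OF P(1)] V(3)])
    show "?P x \<in> closure (range ?P)" by (rule subsetD[OF closure_subset rangeI])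
    fix m assume "m \<in> range ?P"
    then obtain u where u: "m = ?P u" by blast
    have "ip (?P u) (V (T x)) = ip u (adj T (T x))" unfolding V(4)[symmetric] by (rule adjoint(2)[OF T])
    also have "\<dots> = ip (?P u) (?P x)" unfolding abs_op(3)[OF T, symmetric] by (rule P(2)[symmetric])
    finally show "ip m (V (T x)) = ip m (?P x)" unfolding u .
  qed
  have onorm_V: "onorm V \<le> 1" using V(2) by (intro onorm_bound) auto
  have W_le: "norm (adj V x) \<le> norm x" for x
    using adjoint(4)[OF V(1), of x] mult_right_mono[OF onorm_V norm_ge_zero[of x]] by simp
  have WP: "adj V (?P x) = T x" for x
    by (rule eq_if_ip_eq_left) (simp only: adjoint(3)[OF V(1)] V(4))
  show thesis using that[OF V(1) _ VT adjoint(1)[OF V(1)] W_le WP] V(2) by simp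
qed

section \<open>Orthonormal bases\<close>

definition orthonormal :: "'a set \<Rightarrow> bool" where
  "orthonormal E \<longleftrightarrow> (\<forall>e\<in>E. \<forall>e'\<in>E. ip e e' = (if e = e' then 1 else 0))"

lemma orthonormal_subset: "orthonormal E \<Longrightarrow> F \<subseteq> E \<Longrightarrow> orthonormal F"
  unfolding orthonormal_def by blast

lemma orthonormal_basis_iff: "orthonormal_basis E \<longleftrightarrow> orthonormal E \<and> closure (span E) = UNIV"
  unfolding orthonormal_basis_def orthonormal_def ..

lemma orthogonal_span:
  assumes "\<And>e. e \<in> F \<Longrightarrow> ip e v = 0" and "x \<in> span F"
  shows "ip x v = 0"
proof -
  have "subspace {m. ip m v = 0}" by (rule subspaceI) (auto simp: ip_add_left ip_scale_left)
  then have "span F \<subseteq> {m. ip m v = 0}" using assms(1) by (intro span_minimal) auto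
  then show ?thesis using assms(2) by blast
qed

definition fourier_sum :: "'a \<Rightarrow> 'a set \<Rightarrow> 'a" where
  "fourier_sum x F = (\<Sum>e\<in>F. scale (ip x e) e)"

lemma fourier_sum_in_span: "fourier_sum x F \<in> span F"
  unfolding fourier_sum_def by (intro span_sum span_scale span_base)

lemma ip_fourier_sum:
  assumes "finite F" "orthonormal F" "g \<in> F"
  shows "ip (fourier_sum x F) g = ip x g"
proof -
  have "ip (fourier_sum x F) g = (\<Sum>e\<in>F. if e = g then ip x e else 0)"
    unfolding fourier_sum_def ip_sum_left ip_scale_left
    by (rule sum.cong) (use assms in \<open>auto simp: orthonormal_def\<close>)
  then show ?thesis using assms by simp
qed

lemma fourier_residual_orthogonal:
  assumes "finite F" "orthonormal F" "u \<in> span F"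
  shows "ip u (x - fourier_sum x F) = 0"
proof (rule orthogonal_span[OF _ assms(3)])
  fix e assume "e \<in> F"
  then have "ip (x - fourier_sum x F) e = 0" by (simp add: ip_diff_left ip_fourier_sum assms)
  then show "ip e (x - fourier_sum x F) = 0" by (rule ip_eq_zero_sym)
qed

lemma fourier_best_approximation:
  assumes "finite F" "orthonormal F" "u \<in> span F"
  shows "norm (x - fourier_sum x F) \<le> norm (x - u)"
proof -
  let ?p = "fourier_sum x F"
  have "ip (?p - u) (x - ?p) = 0"
    by (intro fourier_residual_orthogonal assms span_diff fourier_sum_in_span)
  then have "(norm ((?p - u) + (x - ?p)))\<^sup>2 = (norm (?p - u))\<^sup>2 + (norm (x - ?p))\<^sup>2"
    unfolding norm_add_sq by simp
  then have "(norm (x - ?p))\<^sup>2 \<le> (norm (x - u))\<^sup>2" by simp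
  then show ?thesis by (rule power2_le_imp_le) simp
qed

lemma Bessel:
  assumes "finite F" "orthonormal F"
  shows "(\<Sum>e\<in>F. (norm (ip x e))\<^sup>2) \<le> (norm x)\<^sup>2"
proof -
  let ?p = "fourier_sum x F"
  have "ip ?p ?p = (\<Sum>e\<in>F. rcnj (ip x e) * ip ?p e)"
    unfolding fourier_sum_def[of x F] ip_sum_right ip_scale_right ..
  also have "\<dots> = (\<Sum>e\<in>F. of_real ((norm (ip x e))\<^sup>2))"
  proof (rule sum.cong)
    fix e assume "e \<in> F"
    then have "rcnj (ip x e) * ip ?p e = ip x e * rcnj (ip x e)"
      using assms by (simp add: ip_fourier_sum mult.commute)
    then show "rcnj (ip x e) * ip ?p e = of_real ((norm (ip x e))\<^sup>2)" unfolding mult_rcnj .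
  qed simp
  finally have "(of_real ((norm ?p)\<^sup>2) :: 'f) = of_real (\<Sum>e\<in>F. (norm (ip x e))\<^sup>2)"
    unfolding ip_self of_real_sum .
  then have p: "(norm ?p)\<^sup>2 = (\<Sum>e\<in>F. (norm (ip x e))\<^sup>2)" unfolding of_real_eq_iff .
  have "ip ?p (x - ?p) = 0"
    by (intro fourier_residual_orthogonal assms fourier_sum_in_span)
  then have "(norm (?p + (x - ?p)))\<^sup>2 = (norm ?p)\<^sup>2 + (norm (x - ?p))\<^sup>2"
    unfolding norm_add_sq by simp
  then show ?thesis using p by simp
qed

text \<open>
  A finite linear combination of basis vectors that is close to \<open>x\<close> is beaten by every Fourier sum
  over a larger finite set, so the net of Fourier sums converges, whatever the cardinality of \<open>E\<close>.
\<close>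

lemma fourier_expansion:
  assumes E: "orthonormal_basis E"
  shows "((\<lambda>e. scale (ip x e) e) has_sum x) E"
  unfolding has_sum_def
proof (rule tendstoI)
  fix \<epsilon> :: real assume "\<epsilon> > 0"
  have "x \<in> closure (span E)" using E by (simp add: orthonormal_basis_iff)
  then obtain u where u: "u \<in> span E" "dist u x < \<epsilon>"
    using \<open>\<epsilon> > 0\<close> unfolding closure_approachable by blast
  then obtain F0 r where F0: "finite F0" "F0 \<subseteq> E" "u = (\<Sum>e\<in>F0. scale (r e) e)"
    unfolding span_explicit by blast
  have "dist (\<Sum>e\<in>F. scale (ip x e) e) x < \<epsilon>" if F: "finite F" "F0 \<subseteq> F" "F \<subseteq> E" for F
  proof -
    have "u \<in> span F" unfolding F0(3) using F0(2) F(2) by (intro span_sum span_scale span_base) auto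
    then have "norm (x - fourier_sum x F) \<le> norm (x - u)"
      using F E by (intro fourier_best_approximation) (auto simp: orthonormal_basis_iff intro: orthonormal_subset)
    then show ?thesis using u(2) by (simp add: fourier_sum_def dist_norm norm_minus_commute)
  qed
  then show "\<forall>\<^sub>F F in finite_subsets_at_top E. dist (\<Sum>e\<in>F. scale (ip x e) e) x < \<epsilon>"
    unfolding eventually_finite_subsets_at_top using F0 by blast
qed

text \<open>
  Without a basis the trace norm would be undetermined. A maximal orthonormal set \<open>E\<close> exists by
  Zorn's lemma; a vector \<open>x\<close> outside the closure of its span minus its projection \<open>v\<close> to that
  closure is orthogonal to \<open>E\<close> and could be added after normalization.
\<close>

lemma orthonormal_basis_exists: "\<exists>E. orthonormal_basis E"
proof -
  have "\<Union>C \<in> Collect orthonormal" if C: "subset.chain (Collect orthonormal) C" for C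
  proof -
    have "\<exists>D\<in>C. a \<in> D \<and> b \<in> D" if "a \<in> \<Union>C" "b \<in> \<Union>C" for a b
      using C that unfolding subset_chain_def by blast
    moreover have "D \<in> C \<Longrightarrow> orthonormal D" for D using C unfolding subset_chain_def by blast
    ultimately show ?thesis unfolding orthonormal_def mem_Collect_eq by meson
  qed
  from subset_Zorn'[OF this] obtain E where E: "orthonormal E"
    and max: "\<And>D. orthonormal D \<Longrightarrow> E \<subseteq> D \<Longrightarrow> D = E" by auto
  have "x \<in> closure (span E)" for x
  proof (rule ccontr)
    assume x: "x \<notin> closure (span E)"
    \<comment> \<open>\<open>v\<close> is the orthogonal projection of \<open>x\<close>\<close>
    obtain v where v: "v \<in> closure ((\<lambda>x. x) ` span E)" "\<And>u. u \<in> span E \<Longrightarrow> ip u x = ip u v"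
      by (rule representation[of "span E" scale "\<lambda>x. x" "\<lambda>u. ip u x" "norm x"])
        (auto simp: span_zero span_add span_scale scale_of_real ip_add_left ip_scale_left mult.commute
          intro: order_trans[OF Cauchy_Schwarz])
    define w where "w = (1 / norm (x - v)) *\<^sub>R (x - v)"
    have "x - v \<noteq> 0" using x v(1) by auto
    then have ww: "ip w w = 1" by (simp add: ip_self w_def)
    have ew: "ip e w = 0" if "e \<in> E" for e
      using v(2)[OF span_base[OF that]] by (simp add: w_def ip_scaleR_right ip_diff_right del: of_real_divide)
    then have we: "ip w e = 0" if "e \<in> E" for e using that by (blast intro: ip_eq_zero_sym)
    have "w \<notin> E" using ww ew[of w] by auto
    moreover have "orthonormal (insert w E)"
      using E ww ew we \<open>w \<notin> E\<close> unfolding orthonormal_def by auto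
    ultimately show False using max[of "insert w E"] by blast
  qed
  then have "orthonormal_basis E" using E by (auto simp: orthonormal_basis_iff)
  then show ?thesis ..
qed

lemma dual_Bessel:
  assumes f: "f \<in> dual" and F: "finite F" "orthonormal F"
  shows "(\<Sum>e\<in>F. (norm (f e))\<^sup>2) \<le> (onorm f)\<^sup>2"
proof -
  have f': "bounded_linear f" "\<And>c x. f (scale c x) = c * f x" using f by (auto simp: dual_def)
  note pos = onorm_pos_le[OF f'(1)]
  obtain z where z: "norm z \<le> onorm f \<or> z = 0" "\<And>u. f u = ip u z"
    by (rule representation[of UNIV scale "\<lambda>x. x" f "onorm f"])
      (auto simp: scale_of_real f'(2) linear_simps[OF f'(1)] onorm[OF f'(1)])
  have "(\<Sum>e\<in>F. (norm (f e))\<^sup>2) = (\<Sum>e\<in>F. (norm (ip z e))\<^sup>2)"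
    unfolding z(2) by (metis ip_commute norm_rcnj)
  also have "\<dots> \<le> (norm z)\<^sup>2" by (rule Bessel[OF F])
  also have "\<dots> \<le> (onorm f)\<^sup>2" using z(1) pos by (intro power_mono) auto
  finally show ?thesis .
qed

section \<open>Trace and nuclear norm\<close>

abbreviation abs_diag :: "('a \<Rightarrow> 'a) \<Rightarrow> 'a \<Rightarrow> real" where
  "abs_diag T e \<equiv> rip (abs_op T e) e"

text \<open>
  The trace does not exceed the nuclear norm: apply \<open>V\<close> to the nuclear representation of \<open>T e\<close> and
  bound the contribution of each \<open>k\<close> over \<open>F\<close> by the product of two square sums, both controlled by
  Bessel's inequality.
\<close>

lemma sum_abs_diag_le:
  assumes T: "bounded_op T" and rep: "nuclear_rep T f y" and F: "finite F" "orthonormal F"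
  shows "(\<Sum>e\<in>F. abs_diag T e) \<le> (\<Sum>k. onorm (f k) * norm (y k))"
proof -
  have f: "\<And>k. f k \<in> dual" and summable: "summable (\<lambda>k. onorm (f k) * norm (y k))"
    and sums: "\<And>x. (\<lambda>k. scale (f k x) (y k)) sums T x"
    using rep by (auto simp: nuclear_rep_def)
  obtain V where V: "bounded_op V" "\<And>x. norm (V x) \<le> norm x" "\<And>x. V (T x) = abs_op T x"
    using polar_decomposition[OF T] by metis
  have "(\<lambda>k. re_part (f k e * ip (V (y k)) e)) sums abs_diag T e" for e
  proof -
    have "bounded_linear (\<lambda>z. re_part (ip (V z) e))"
      by (intro bounded_linear_compose[OF bounded_linear_re_part]
          bounded_linear_compose[OF bounded_bilinear.bounded_linear_left[OF bounded_bilinear_ip]]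
          bounded_op_linear V)
    from bounded_linear.sums[OF this sums[of e]] show ?thesis
      by (simp add: V(3) bounded_op_scale[OF V(1)] ip_scale_left)
  qed
  then have "(\<lambda>k. \<Sum>e\<in>F. re_part (f k e * ip (V (y k)) e)) sums (\<Sum>e\<in>F. abs_diag T e)"
    by (rule sums_sum)
  moreover have "(\<Sum>e\<in>F. re_part (f k e * ip (V (y k)) e)) \<le> onorm (f k) * norm (y k)" for k
  proof -
    let ?g = "\<lambda>e. norm (f k e)" and ?h = "\<lambda>e. norm (ip (V (y k)) e)"
    have pos: "0 \<le> onorm (f k)" using f[of k] by (auto simp: dual_def intro: onorm_pos_le)
    have "re_part (f k e * ip (V (y k)) e) \<le> \<bar>?g e\<bar> * \<bar>?h e\<bar>" for e
      using abs_re_part_le_norm[of "f k e * ip (V (y k)) e"] by (simp add: norm_mult)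
    then have "(\<Sum>e\<in>F. re_part (f k e * ip (V (y k)) e)) \<le> (\<Sum>e\<in>F. \<bar>?g e\<bar> * \<bar>?h e\<bar>)"
      by (rule sum_mono)
    also have "\<dots> \<le> L2_set ?g F * L2_set ?h F" by (rule L2_set_mult_ineq)
    also have "\<dots> \<le> onorm (f k) * norm (y k)"
    proof (rule mult_mono)
      show "L2_set ?g F \<le> onorm (f k)"
        unfolding L2_set_def using dual_Bessel[OF f F, of k] pos by (rule real_le_lsqrt[rotated])
      have "L2_set ?h F \<le> norm (V (y k))"
        unfolding L2_set_def using Bessel[OF F, of "V (y k)"] by (intro real_le_lsqrt) auto
      then show "L2_set ?h F \<le> norm (y k)" using V(2)[of "y k"] by linarith
    qed (use pos in \<open>auto intro: L2_set_nonneg\<close>)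
    finally show ?thesis .
  qed
  ultimately show ?thesis using summable by (intro sums_le[OF _ _ summable_sums]) auto
qed

text \<open>
  Nuclear representations are indexed by the natural numbers, while the basis may be uncountable.
  The nonzero values of \<open>q\<close> on \<open>E\<close> are placed at the codes of their arguments and zeros are put
  everywhere else, which also covers the case of finitely many nonzero values.
\<close>

definition nonzero_seq :: "('a \<Rightarrow> 'a) \<Rightarrow> 'a set \<Rightarrow> nat \<Rightarrow> 'a" where
  "nonzero_seq q E k =
     (let D = {e \<in> E. q e \<noteq> 0}
      in if k \<in> to_nat_on D ` D then q (inv_into D (to_nat_on D) k) else 0)"

lemma has_sum_nonzero_seq:
  assumes "countable {e \<in> E. q e \<noteq> 0}" and F0: "F 0 = 0"
  shows "((\<lambda>k. F (nonzero_seq q E k)) has_sum s) UNIV \<longleftrightarrow> ((\<lambda>e. F (q e)) has_sum s) E"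
proof -
  define D where "D = {e \<in> E. q e \<noteq> 0}"
  have inj: "inj_on (to_nat_on D) D" using assms(1) unfolding D_def by (rule inj_on_to_nat_on)
  note seq = nonzero_seq_def[of q E, folded D_def, unfolded Let_def]
  have "((\<lambda>k. F (nonzero_seq q E k)) has_sum s) UNIV
      \<longleftrightarrow> ((\<lambda>k. F (nonzero_seq q E k)) has_sum s) (to_nat_on D ` D)"
    by (rule has_sum_cong_neutral) (auto simp: seq F0)
  also have "\<dots> \<longleftrightarrow> ((\<lambda>e. F (q e)) has_sum s) D"
    unfolding has_sum_reindex[OF inj] by (rule has_sum_cong) (simp add: seq inj)
  also have "\<dots> \<longleftrightarrow> ((\<lambda>e. F (q e)) has_sum s) E"
    by (rule has_sum_cong_neutral) (auto simp: D_def F0)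
  finally show ?thesis .
qed

text \<open>
  With \<open>Q\<close> the square root of \<open>|T|\<close>, the representation is \<open>T x = \<Sum>\<^sub>e \<langle>x; Q e\<rangle> W Q e\<close>, the image under
  \<open>W Q\<close> of the Fourier expansion of \<open>Q x\<close>. Splitting \<open>|T|\<close> evenly into two factors \<open>Q\<close> is what makes
  the product of the norms at most \<open>\<parallel>Q e\<parallel>\<^sup>2 = \<langle>|T| e; e\<rangle>\<close>.
\<close>

lemma nuclear_rep_of_trace:
  assumes T: "bounded_op T" and E: "orthonormal_basis E" and tr: "(abs_diag T has_sum t) E"
  shows "\<exists>f y. nuclear_rep T f y \<and> (\<Sum>k. onorm (f k) * norm (y k)) \<le> t"
proof -
  define Q where "Q = sqrt_op (abs_op T)"
  note Q_pos = sqrt_op(1)[OF abs_op(1)[OF T], folded Q_def]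
    and QQ = sqrt_op(2)[OF abs_op(1)[OF T], folded Q_def]
  note Q = positiveD[OF Q_pos]
  obtain W where W: "bounded_op W" "\<And>x. norm (W x) \<le> norm x" "\<And>x. W (abs_op T x) = T x"
    using polar_decomposition[OF T] by metis
  have diag: "abs_diag T e = (norm (Q e))\<^sup>2" for e
    using Q(2)[of "Q e" e] by (simp add: QQ)
  have "countable {e \<in> E. abs_diag T e \<noteq> 0}"
    using tr by (intro summable_countable_real) (auto simp: summable_on_def)
  then have D: "countable {e \<in> E. Q e \<noteq> 0}" by (simp add: diag)
  define g where "g = nonzero_seq Q E"
  define f where "f k x = ip x (g k)" for k x
  define y where "y k = W (g k)" for k
  have f_bl: "bounded_linear (f k)" for k
    unfolding f_def by (rule bounded_bilinear.bounded_linear_left[OF bounded_bilinear_ip])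
  have f_onorm: "onorm (f k) \<le> norm (g k)" for k
    by (rule onorm_bound) (use Cauchy_Schwarz in \<open>auto simp: f_def mult.commute\<close>)
  have f: "f k \<in> dual" for k
    unfolding dual_def using f_bl by (simp add: f_def ip_scale_left)
  have le: "onorm (f k) * norm (y k) \<le> (norm (g k))\<^sup>2" for k
    unfolding power2_eq_square y_def by (intro mult_mono f_onorm W) auto
  have "((\<lambda>k. (norm (g k))\<^sup>2) has_sum t) UNIV"
    unfolding g_def using tr by (subst has_sum_nonzero_seq[OF D]) (simp_all add: diag)
  then have g_sums: "(\<lambda>k. (norm (g k))\<^sup>2) sums t" by (rule has_sum_imp_sums)
  have nonneg: "0 \<le> onorm (f k) * norm (y k)" for k by (intro mult_nonneg_nonneg onorm_pos_le f_bl) auto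
  have summable: "summable (\<lambda>k. onorm (f k) * norm (y k))"
    by (rule summable_comparison_test'[OF sums_summable[OF g_sums]]) (use le nonneg in auto)
  have "(\<lambda>k. scale (f k x) (y k)) sums T x" for x
  proof -
    have "bounded_linear (\<lambda>z. W (Q z))"
      by (intro bounded_linear_compose[of W Q] bounded_op_linear W Q)
    from has_sum_bounded_linear[OF this fourier_expansion[OF E, of "Q x"]]
    have "((\<lambda>e. scale (ip x (Q e)) (W (Q e))) has_sum T x) E"
      by (simp add: o_def bounded_op_scale[OF Q(1)] bounded_op_scale[OF W(1)] QQ W(3) Q(2))
    then have "((\<lambda>k. scale (ip x (g k)) (W (g k))) has_sum T x) UNIV"
      unfolding g_def by (subst has_sum_nonzero_seq[OF D]) simp_all
    then show ?thesis unfolding f_def y_def by (rule has_sum_imp_sums)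
  qed
  then have "nuclear_rep T f y" unfolding nuclear_rep_def using f summable by blast
  moreover have "(\<Sum>k. onorm (f k) * norm (y k)) \<le> t"
    using le by (intro sums_le[OF _ summable_sums[OF summable] g_sums])
  ultimately show ?thesis by blast
qed

lemma abs_diag_nonneg: "bounded_op T \<Longrightarrow> 0 \<le> abs_diag T e"
  by (rule positiveD(3)[OF abs_op(1)])

lemma ip_abs_op: "bounded_op T \<Longrightarrow> ip (abs_op T e) e = of_real (abs_diag T e)"
  by (rule positive_ip[OF abs_op(1)])

lemma trace_summable_iff:
  assumes T: "bounded_op T"
  shows "(\<lambda>e. ip (abs_op T e) e) summable_on E \<longleftrightarrow> abs_diag T summable_on E"
proof
  assume "(\<lambda>e. ip (abs_op T e) e) summable_on E"
  from summable_on_bounded_linear[OF bounded_linear_re_part this]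
  show "abs_diag T summable_on E" by (simp add: o_def)
next
  assume "abs_diag T summable_on E"
  from summable_on_of_real[OF this, where 'a = 'f]
  show "(\<lambda>e. ip (abs_op T e) e) summable_on E" by (rule summable_on_cong[THEN iffD2, rotated]) (rule ip_abs_op[OF T])
qed

lemma trace_class_eq_nuclear: "trace_class = nuclear"
proof (intro set_eqI iffI)
  fix T assume "T \<in> trace_class"
  then have T: "bounded_op T"
    and tr: "\<And>E. orthonormal_basis E \<Longrightarrow> abs_diag T summable_on E"
    using trace_summable_iff[of T] by (auto simp: trace_class_def)
  obtain E where E: "orthonormal_basis E" using orthonormal_basis_exists by blast
  from nuclear_rep_of_trace[OF T E has_sum_infsum[OF tr[OF E]]]
  show "T \<in> nuclear" using T unfolding nuclear_def by blast
next
  fix T assume "T \<in> nuclear"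
  then obtain f y where T: "bounded_op T" and rep: "nuclear_rep T f y"
    unfolding nuclear_def by blast
  have "abs_diag T summable_on E" if "orthonormal_basis E" for E
  proof (rule nonneg_bdd_above_summable_on)
    show "bdd_above (sum (abs_diag T) ` {F. F \<subseteq> E \<and> finite F})"
      using that by (intro bdd_aboveI2[where M = "\<Sum>k. onorm (f k) * norm (y k)"] sum_abs_diag_le[OF T rep])
        (auto simp: orthonormal_basis_iff intro: orthonormal_subset)
  qed (rule abs_diag_nonneg[OF T])
  then show "T \<in> trace_class" using T trace_summable_iff[OF T] by (auto simp: trace_class_def)
qed

text \<open>
  The trace sum \<open>t\<close> over \<open>E\<close> is a lower bound for all nuclear representations, and one of them has sum
  at most \<open>t\<close>; so the infimum is attained and equals \<open>t\<close>, for every \<open>E\<close>.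
\<close>

lemma has_sum_abs_diag_nuclear_norm:
  assumes T: "T \<in> trace_class" and E: "orthonormal_basis E"
  shows "(abs_diag T has_sum nuclear_norm T) E"
proof -
  have bT: "bounded_op T" and "abs_diag T summable_on E"
    using T E trace_summable_iff[of T] by (auto simp: trace_class_def)
  then obtain t where t: "(abs_diag T has_sum t) E" by (auto simp: summable_on_def)
  have lower: "t \<le> (\<Sum>k. onorm (f k) * norm (y k))" if "nuclear_rep T f y" for f y
  proof (rule has_sum_le_finite_sums[OF t])
    fix F assume "finite F" "F \<subseteq> E"
    then show "sum (abs_diag T) F \<le> (\<Sum>k. onorm (f k) * norm (y k))"
      using E by (intro sum_abs_diag_le[OF bT that]) (auto simp: orthonormal_basis_iff intro: orthonormal_subset)
  qed
  obtain f y where fy: "nuclear_rep T f y" "(\<Sum>k. onorm (f k) * norm (y k)) \<le> t"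
    using nuclear_rep_of_trace[OF bT E t] by blast
  have "nuclear_norm T = t"
    unfolding nuclear_norm_def
  proof (rule cInf_eq_minimum)
    show "t \<in> {\<Sum>k. onorm (f k) * norm (y k) | f y. nuclear_rep T f y}"
      using fy lower[OF fy(1)] by force
  qed (use lower in auto)
  then show ?thesis using t by simp
qed

lemma trace_norm_eq_nuclear_norm:
  assumes T: "T \<in> trace_class"
  shows "trace_norm T = nuclear_norm T"
  unfolding trace_norm_def
proof (rule the_equality)
  have bT: "bounded_op T" using T by (simp add: trace_class_def)
  show *: "\<forall>E. orthonormal_basis E \<longrightarrow>
      ((\<lambda>e. ip (abs_op T e) e) has_sum of_real (nuclear_norm T)) E"
  proof (intro allI impI)
    fix E assume "orthonormal_basis E"
    from has_sum_of_real[OF has_sum_abs_diag_nuclear_norm[OF T this], where 'a = 'f]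
    show "((\<lambda>e. ip (abs_op T e) e) has_sum of_real (nuclear_norm T)) E"
      by (rule has_sum_cong[THEN iffD2, rotated]) (rule ip_abs_op[OF bT])
  qed
  fix s assume s: "\<forall>E. orthonormal_basis E \<longrightarrow> ((\<lambda>e. ip (abs_op T e) e) has_sum of_real s) E"
  obtain E where E: "orthonormal_basis E" using orthonormal_basis_exists by blast
  have "(of_real s :: 'f) = of_real (nuclear_norm T)"
    using has_sum_unique s * E by blast
  then show "s = nuclear_norm T" by simp
qed

end

theorem theorem6p1:
  fixes scale :: "'f::rc_scalar \<Rightarrow> 'a::banach \<Rightarrow> 'a"
    and ip :: "'a \<Rightarrow> 'a \<Rightarrow> 'f"
  assumes "hilbert_space scale ip"
  shows "hilbert_space.trace_class scale ip = hilbert_space.nuclear scale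
    \<and> (\<forall>T \<in> hilbert_space.trace_class scale ip.
          hilbert_space.trace_norm scale ip T = hilbert_space.nuclear_norm scale T)"
proof -
  interpret hilbert_space scale ip by (rule assms)
  show ?thesis using trace_class_eq_nuclear trace_norm_eq_nuclear_norm by blast
qed

end
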